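(* Let $\mathcal{L}\subset \mathbb{P}^{2}_{\mathbb{C}}$ be an arrangement of $d$ lines that is not free. Let $t_r$ denote the number of $r$-fold intersection points of $\mathcal{L}$ and $m(\mathcal{L})$ the maximal multiplicity among its intersection points. For a positive integer $h$ define $$\mathcal{P}(\mathcal{L},h;t) = 1 + dt + \left(\sum_{r\geq 2}(r-1)t_{r}-h\right)t^{2}.$$ If, for every integer $h \in \left\{ \left\lceil \frac{2d}{m(\mathcal{L})} -2 \right\rceil, \ldots , d-2\right\}$, the polynomial $\mathcal{P}(\mathcal{L},h;t)$ does not split over the rationals with respect to the variable $t$, then $\mathcal{L}$ is not plus-one generated.
   Context: Let $S=\mathbb{C}[x,y,z]$ with its standard grading. An arrangement of $d$ lines $\mathcal{L}\subset\mathbb{P}^2_{\mathbb{C}}$ is a set of $d$ pairwise distinct lines; it is regarded as the reduced plane curve $f=0$ of degree $d$, where $f\in S$ is the product of linear forms defining the lines. An $r$-fold intersection point (a point of multiplicity $r$) is a point lying on exactly $r$ lines of $\mathcal{L}$. The arrangement is free if its module of derivations is a free $S$-module; equivalently, if ${\rm AR}(f) = \{(a,b,c)\in S^{3} : a\,\partial_x f+b\,\partial_y f+c\,\partial_z f=0\}$ is a free $S$-module. For a reduced plane curve $C:f=0$ of degree $d$, let $J_f=\langle \partial_x f,\partial_y f,\partial_z f\rangle$ be the Jacobian ideal and $M(f)=S/J_f$ the Milnor algebra. $C$ is an $m$-syzygy curve with exponents $(d_1,\ldots,d_m)$ if $M(f)$ has a minimal graded free resolution $$0 \rightarrow \bigoplus_{i=1}^{m-2}S(-e_{i})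 \rightarrow \bigoplus_{i=1}^{m}S(1-d - d_{i}) \rightarrow S^{3}(1-d)\rightarrow S \rightarrow M(f) \rightarrow 0$$ with $e_1\le\cdots\le e_{m-2}$ and $1\le d_1\le\cdots\le d_m$. $C$ is plus-one generated with exponents $(d_1,d_2,d_3)$ if it is a $3$-syzygy curve with these exponents and $d_1+d_2=d$. A polynomial in $t$ splits over the rationals if it is a product of polynomials of degree at most $1$ in $\mathbb{Q}[t]$. *)

theory Defs
  imports
    "HOL-Analysis.Analysis"
    "HOL-Library.Poly_Mapping"
    "HOL-Computational_Algebra.Polynomial"
    "Jordan_Normal_Form.Matrix_Kernel"
begin

unbundle no vec_syntax

section \<open>The graded ring S = C[x,y,z]\<close>

text \<open>
  The variables x, y, z are indexed by the three-element type \<^typ>\<open>3\<close>. A monomial is an exponent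
  vector of type \<^typ>\<open>3 \<Rightarrow>\<^sub>0 nat\<close>, and multiplication of finitely supported functions
  is convolution, so \<open>S\<close> is the polynomial ring in three variables.
\<close>

type_synonym S = "(3 \<Rightarrow>\<^sub>0 nat) \<Rightarrow>\<^sub>0 complex"

definition var :: "3 \<Rightarrow> S" where
  "var i = Poly_Mapping.single (Poly_Mapping.single i 1) 1"

definition const :: "complex \<Rightarrow> S" where
  "const c = Poly_Mapping.single 0 c"

definition mon_degree :: "(3 \<Rightarrow>\<^sub>0 nat) \<Rightarrow> nat" where
  "mon_degree m = (\<Sum>i\<in>UNIV. Poly_Mapping.lookup m i)"

text \<open>
  \<open>p\<close> lies in the graded piece of degree \<open>n\<close>; this piece is zero for negative \<open>n\<close>, and
  the zero polynomial is homogeneous of every degree.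
\<close>

definition homogeneous :: "int \<Rightarrow> S \<Rightarrow> bool" where
  "homogeneous n p \<longleftrightarrow> (\<forall>m\<in>Poly_Mapping.keys p. int (mon_degree m) = n)"

text \<open>
  If \<open>i\<close> does not occur in the monomial \<open>m\<close>, the truncated exponent is harmless because the
  coefficient vanishes.
\<close>

definition partial :: "3 \<Rightarrow> S \<Rightarrow> S" where
  "partial i p = (\<Sum>m\<in>Poly_Mapping.keys p.
     Poly_Mapping.single (m - Poly_Mapping.single i 1)
       (of_nat (Poly_Mapping.lookup m i) * Poly_Mapping.lookup p m))"

interpretation S_ideal: Modules.module "(*) :: S \<Rightarrow> S \<Rightarrow> S"
  by unfold_locales (simp_all add: algebra_simps)

interpretation S_cubed: Modules.module "(*s) :: S \<Rightarrow> S ^ 3 \<Rightarrow> S ^ 3"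
  by unfold_locales
    (simp_all add: vector_add_ldistrib vector_sadd_rdistrib vector_smult_assoc)

definition jacobian_ideal :: "S \<Rightarrow> S set" where
  "jacobian_ideal f = S_ideal.span (range (\<lambda>i. partial i f))"

definition AR :: "S \<Rightarrow> (S ^ 3) set" where
  "AR f = {a. (\<Sum>i\<in>UNIV. vec_nth a i * partial i f) = 0}"

definition free_curve :: "S \<Rightarrow> bool" where
  "free_curve f \<longleftrightarrow> (\<exists>B. S_cubed.independent B \<and> S_cubed.span B = AR f)"

section \<open>Minimal graded free resolutions\<close>

text \<open>
  A list \<open>as = [a\<^sub>1, \<dots>, a\<^sub>n]\<close> of integers stands for the graded free module
  \<open>S(-a\<^sub>1) \<oplus> \<dots> \<oplus> S(-a\<^sub>n)\<close>, whose underlying module is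
  \<open>carrier_vec n\<close>. The following are the matrices of the degree-preserving homomorphisms from
  the module of \<open>as\<close> to the module of \<open>bs\<close>.
\<close>

definition graded_hom :: "int list \<Rightarrow> int list \<Rightarrow> S mat \<Rightarrow> bool" where
  "graded_hom as bs A \<longleftrightarrow> A \<in> carrier_mat (length bs) (length as) \<and>
     (\<forall>i<length bs. \<forall>j<length as. homogeneous (as ! j - bs ! i) (A $$ (i, j)))"

definition mat_image :: "S mat \<Rightarrow> S Matrix.vec set" where
  "mat_image A = (\<lambda>v. A *\<^sub>v v) ` carrier_vec (dim_col A)"

text \<open>The image of the homomorphism lies in (x,y,z) times its target.\<close>

definition minimal_hom :: "S mat \<Rightarrow> bool" where
  "minimal_hom A \<longleftrightarrow> (\<forall>i<dim_row A. \<forall>j<dim_col A. A $$ (i, j) \<in> S_ideal.span (range var))"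

text \<open>
  \<open>S/I\<close> has a minimal graded free resolution
  \<open>0 \<rightarrow> F\<^sub>3 \<rightarrow> F\<^sub>2 \<rightarrow> F\<^sub>1 \<rightarrow> S \<rightarrow> S/I \<rightarrow> 0\<close>, where the graded free
  modules \<open>F\<^sub>1, F\<^sub>2, F\<^sub>3\<close> are given by \<open>as, bs, cs\<close>. Exactness at \<open>S\<close>, the module
  of \<open>[0]\<close>, says that the image of \<open>F\<^sub>1\<close> is the kernel \<open>I\<close> of the projection to \<open>S/I\<close>.
\<close>

definition has_min_graded_resolution :: "S set \<Rightarrow> int list \<Rightarrow> int list \<Rightarrow> int list \<Rightarrow> bool" where
  "has_min_graded_resolution I as bs cs \<longleftrightarrow> (\<exists>A B C.
     graded_hom as [0] A \<and> graded_hom bs as B \<and> graded_hom cs bs C \<and>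
     minimal_hom A \<and> minimal_hom B \<and> minimal_hom C \<and>
     mat_image A = {v \<in> carrier_vec 1. v $ 0 \<in> I} \<and>
     mat_kernel A = mat_image B \<and>
     mat_kernel B = mat_image C \<and>
     mat_kernel C = {0\<^sub>v (length cs)})"

text \<open>
  For a form \<open>f\<close> of degree \<open>d\<close>, with exponents \<open>ds = [d\<^sub>1, \<dots>, d\<^sub>m]\<close>. The shifts in
  \<open>S(1 - d)\<close> and \<open>S(1 - d - d\<^sub>i)\<close> are written as \<open>-(d - 1)\<close> and \<open>-(d - 1 + d\<^sub>i)\<close>.
\<close>

definition syzygy_curve :: "nat \<Rightarrow> S \<Rightarrow> nat list \<Rightarrow> bool" where
  "syzygy_curve d f ds \<longleftrightarrow> sorted ds \<and> (\<forall>x\<in>set ds. 1 \<le> x) \<and>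
     (\<exists>es :: int list. sorted es \<and> length ds = length es + 2 \<and>
        has_min_graded_resolution (jacobian_ideal f)
          (replicate 3 (int d - 1)) (map (\<lambda>x. int d - 1 + int x) ds) es)"

definition plus_one_generated_with :: "nat \<Rightarrow> S \<Rightarrow> nat \<Rightarrow> nat \<Rightarrow> nat \<Rightarrow> bool" where
  "plus_one_generated_with d f d1 d2 d3 \<longleftrightarrow> syzygy_curve d f [d1, d2, d3] \<and> d1 + d2 = d"

definition plus_one_generated :: "nat \<Rightarrow> S \<Rightarrow> bool" where
  "plus_one_generated d f \<longleftrightarrow> (\<exists>d1 d2 d3. plus_one_generated_with d f d1 d2 d3)"

section \<open>Line arrangements in the complex projective plane\<close>

text \<open>
  Points and lines of the projective plane are the linear subspaces of dimension 1 and 2 of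
  \<^typ>\<open>complex ^ 3\<close>; a point \<open>P\<close> lies on a line \<open>L\<close> iff \<open>P \<subseteq> L\<close>.
\<close>

definition proj_point :: "(complex ^ 3) set \<Rightarrow> bool" where
  "proj_point P \<longleftrightarrow> vec.subspace P \<and> vec.dim P = 1"

definition proj_line :: "(complex ^ 3) set \<Rightarrow> bool" where
  "proj_line L \<longleftrightarrow> vec.subspace L \<and> vec.dim L = 2"

definition line_arrangement :: "(complex ^ 3) set set \<Rightarrow> bool" where
  "line_arrangement \<L> \<longleftrightarrow> finite \<L> \<and> (\<forall>L\<in>\<L>. proj_line L)"

definition linear_form :: "complex ^ 3 \<Rightarrow> S" where
  "linear_form \<alpha> = (\<Sum>i\<in>UNIV. const (vec_nth \<alpha> i) * var i)"

definition zeros_linear_form :: "complex ^ 3 \<Rightarrow> (complex ^ 3) set" where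
  "zeros_linear_form \<alpha> = {v. (\<Sum>i\<in>UNIV. vec_nth \<alpha> i * vec_nth v i) = 0}"

text \<open>A defining polynomial is determined only up to a nonzero constant, hence a predicate.\<close>

definition defining_polynomial :: "(complex ^ 3) set set \<Rightarrow> S \<Rightarrow> bool" where
  "defining_polynomial \<L> f \<longleftrightarrow>
     (\<exists>\<alpha>. (\<forall>L\<in>\<L>. L = zeros_linear_form (\<alpha> L)) \<and> f = (\<Prod>L\<in>\<L>. linear_form (\<alpha> L)))"

definition mult_at :: "(complex ^ 3) set set \<Rightarrow> (complex ^ 3) set \<Rightarrow> nat" where
  "mult_at \<L> P = card {L \<in> \<L>. P \<subseteq> L}"

definition t_num :: "(complex ^ 3) set set \<Rightarrow> nat \<Rightarrow> nat" where
  "t_num \<L> r = card {P. proj_point P \<and> mult_at \<L> P = r}"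

definition max_mult :: "(complex ^ 3) set set \<Rightarrow> nat" where
  "max_mult \<L> = Max {mult_at \<L> P | P. proj_point P \<and> mult_at \<L> P \<ge> 2}"

text \<open>The sum over \<open>r\<close> stops at the number of lines since no point has a larger multiplicity.\<close>

definition P_poly :: "(complex ^ 3) set set \<Rightarrow> int \<Rightarrow> rat poly" where
  "P_poly \<L> h = [: 1, of_nat (card \<L>),
     of_int ((\<Sum>r = 2..card \<L>. (int r - 1) * int (t_num \<L> r)) - h) :]"

definition splits_over_rationals :: "rat poly \<Rightarrow> bool" where
  "splits_over_rationals p \<longleftrightarrow> (\<exists>qs. (\<forall>q\<in>set qs. Polynomial.degree q \<le> 1) \<and> p = prod_list qs)"

end

theory Submission
  imports Defs
begin

text \<open>
  Let the arrangement \<open>\<A>\<close> be plus-one generated with exponents \<open>d\<^sub>1 \<le> d\<^sub>2 \<le> d\<^sub>3\<close>, and let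
  \<open>b\<^sub>2 = \<Sum>\<^sub>r (r - 1) t\<^sub>r\<close>. The resolution determines the Hilbert function of the module
  \<open>D(\<A>)\<close> of derivations. On the other hand, adding a line \<open>a = 0\<close> to \<open>d'\<close> lines \<open>\<A>'\<close> that meet it
  in \<open>n\<close> points gives an exact sequence
  \<open>0 \<rightarrow> D(\<A>)\<^sub>k \<rightarrow> D(\<A>')\<^sub>k \<rightarrow> (S/a)\<^bsub>k-d'+n\<^esub> \<rightarrow> 0\<close> for \<open>k \<ge> d' - 2\<close>, whose last map is
  \<open>\<theta> \<mapsto> \<theta>(a)\<close> divided by a form on the line that vanishes to order \<open>m - 1\<close> at each point on \<open>m\<close> of the
  lines \<open>\<A>'\<close>. By induction the Hilbert function of \<open>D(\<A>)\<close> in degrees \<open>k \<ge> d - 3\<close> is an explicit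
  polynomial that depends only on \<open>d\<close> and \<open>b\<^sub>2\<close>. Comparing the two yields \<open>b\<^sub>2 = d\<^sub>1 d\<^sub>2 + d\<^sub>3\<close> and, because
  the Hilbert function of the resolution differs from its polynomial in degree \<open>d\<^sub>3 - 2\<close>, also
  \<open>d\<^sub>3 \<le> d - 2\<close>. Hence \<open>1 + d t + (b\<^sub>2 - d\<^sub>3) t\<^sup>2 = (1 + d\<^sub>1 t) (1 + d\<^sub>2 t)\<close>. The lower bound
  \<open>d\<^sub>3 \<ge> 2 d / m - 2\<close> is purely numerical: it follows from \<open>d \<le> 2 d\<^sub>3\<close> and
  \<open>d (d - 1) = \<Sum>\<^sub>r r (r - 1) t\<^sub>r \<le> m b\<^sub>2\<close>.
\<close>

section \<open>Finite-dimensional subspaces\<close>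

text \<open>The range k \<ge> d - 3 is what closes the argument. If d3 were at least d - 1, the
  degree d3 - 2 would fall into this range, where adding lines yields a polynomial count. The
  deviation there has a single source: the second syzygy sits in degree d3 + 1 after removal of the
  twist d - 1, so its binomial is evaluated at -3, where it is 1 while the space of forms is 0.

  The obstacle is surjectivity of the last map in a degree as low as d' - 2. It comes from explicit
  derivations: for two points of the new line, the cross product of the gradients of the products of
  the lines through each, times the remaining lines. For n \<ge> 2 these have degree d' - 2 and
  restrict, up to the common factor, to products omitting one node of Lagrange interpolation; n - 1
  of them span the target.

  All of this is dimension counting over \<complex> in single degrees. The new line is parametrized
  as u + t v with v on no other line, so that forms on it become polynomials in t of bounded
  degree.\<close>

context vector_space
begin

text \<open>The polynomial ring has infinite dimension over \<complex>, so \<open>dim\<close> is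
  informative only for subspaces inside a finite span; this predicate guards the dimension
  counts.\<close>

definition fin_dim :: "'b set \<Rightarrow> bool" where
  "fin_dim V \<longleftrightarrow> local.subspace V \<and> (\<exists>F. finite F \<and> V \<subseteq> local.span F)"

lemma fin_dim_basis:
  assumes "local.fin_dim V"
  obtains B where "finite B" "\<not> local.dependent B" "B \<subseteq> V" "local.span B = V" "card B = local.dim V"
proof -
  obtain F where F: "finite F" "V \<subseteq> local.span F" and V: "local.subspace V"
    using assms by (auto simp: fin_dim_def)
  obtain B where B: "B \<subseteq> V" "\<not> local.dependent B" "V \<subseteq> local.span B" "card B = local.dim V"
    using basis_exists by blast
  have "finite B"
    using independent_span_bound[OF F(1) B(2)] B(1) F(2) by auto
  moreover have "local.span B = V"
    using B V by (simp add: span_minimal subset_antisym)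
  ultimately show thesis using B that by blast
qed

lemma fin_dim_subset: "local.fin_dim V \<Longrightarrow> local.subspace W \<Longrightarrow> W \<subseteq> V \<Longrightarrow> local.fin_dim W"
  by (auto simp: fin_dim_def)

text \<open>A linear map that kills \<open>A\<close> and fixes \<open>C\<close> pointwise is zero on
  one span and the identity on the other.\<close>

lemma independent_span_Int:
  assumes "\<not> local.dependent (A \<union> C)" "A \<inter> C = {}"
  shows "local.span A \<inter> local.span C = {0}"
proof -
  interpret vector_space_pair scale scale by unfold_locales
  obtain g where g: "Vector_Spaces.linear scale scale g"
      and gx: "\<And>x. x \<in> A \<union> C \<Longrightarrow> g x = (if x \<in> C then x else 0)"
    using linear_independent_extend[OF assms(1), of "\<lambda>x. if x \<in> C then x else 0"] by auto
  interpret g: Vector_Spaces.linear scale scale g by fact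
  have "g x = 0" if "x \<in> local.span A" for x
    using that by (rule g.eq_0_on_span[rotated]) (use gx assms(2) in auto)
  moreover have "g x = x" if "x \<in> local.span C" for x
    using linear_eq_on[OF g linear_id that] gx by (auto simp: id_def)
  ultimately have "x = 0" if "x \<in> local.span A \<inter> local.span C" for x
    using that by (metis IntD1 IntD2)
  then show ?thesis using local.span_zero by blast
qed

lemma fin_dim_zero [simp]: "local.fin_dim {0}"
  by (auto simp: fin_dim_def subspace_0 intro!: exI[of _ "{}"])

lemma dim_zero [simp]: "local.dim {0} = 0"
  using dim_unique[of "{}" "{0}" 0] by (simp add: independent_empty)

end

context vector_space_pair
begin

lemma subspace_kernel_on:
  assumes "Vector_Spaces.linear s1 s2 f" "vs1.subspace V"
  shows "vs1.subspace {v \<in> V. f v = 0}"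
proof -
  interpret f: Vector_Spaces.linear s1 s2 f by fact
  have "{v \<in> V. f v = 0} = V \<inter> {v. f v = 0}" by auto
  then show ?thesis
    using assms(2) f.subspace_kernel by (simp add: vs1.subspace_inter)
qed

text \<open>A basis \<open>A\<close> of the kernel is extended to a basis \<open>B\<close> of
  \<open>V\<close>; \<open>f\<close> is injective on the span of \<open>B - A\<close>, so the images
  of these vectors form a basis of the image.\<close>

lemma rank_nullity:
  assumes lin: "Vector_Spaces.linear s1 s2 f" and V: "vs1.fin_dim V"
  shows "vs2.fin_dim (f ` V)" "vs1.dim V = vs1.dim {v \<in> V. f v = 0} + vs2.dim (f ` V)"
proof -
  interpret f: Vector_Spaces.linear s1 s2 f by fact
  define K where "K = {v \<in> V. f v = 0}"
  have Vs: "vs1.subspace V" using V by (simp add: vs1.fin_dim_def)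
  have K: "vs1.fin_dim K"
    using vs1.fin_dim_subset[OF V subspace_kernel_on[OF lin Vs]] by (auto simp: K_def)
  obtain F where F: "finite F" "V \<subseteq> vs1.span F"
    using V by (auto simp: vs1.fin_dim_def)
  obtain A where A: "finite A" "vs1.independent A" "A \<subseteq> K" "vs1.span A = K" "card A = vs1.dim K"
    using vs1.fin_dim_basis[OF K] by blast
  obtain B where B: "A \<subseteq> B" "B \<subseteq> V" "vs1.independent B" "V \<subseteq> vs1.span B"
    using vs1.maximal_independent_subset_extend[of A V] A K_def by blast
  have finB: "finite B"
    using vs1.independent_span_bound[OF F(1) B(3)] B(2) F(2) by auto
  have spanB: "vs1.span B = V"
    using B Vs by (simp add: vs1.span_minimal subset_antisym)
  have cardB: "card B = vs1.dim V"
    using vs1.basis_card_eq_dim[OF B(2,4,3)] .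
  define C where "C = B - A"
  have inj: "inj_on f (vs1.span C)"
    unfolding f.inj_on_iff_eq_0[OF vs1.subspace_span]
  proof safe
    fix x assume x: "x \<in> vs1.span C" "f x = 0"
    have "x \<in> K"
      using x vs1.span_mono[of C B] spanB by (auto simp: K_def C_def)
    then have "x \<in> vs1.span A" using A by simp
    show "x = 0"
    proof (rule ccontr)
      assume "x \<noteq> 0"
      have "vs1.span A \<inter> vs1.span C = {0}"
        using vs1.independent_span_Int[of A C] B(1,3) by (auto simp: C_def Un_absorb1)
      then show False using x \<open>x \<in> vs1.span A\<close> \<open>x \<noteq> 0\<close> by auto
    qed
  qed
  have indC: "vs1.independent C" using vs1.independent_mono[OF B(3)] by (auto simp: C_def)
  have indfC: "vs2.independent (f ` C)"
    using linear_independent_injective_image[OF lin indC inj] .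
  have spanfC: "vs2.span (f ` C) = f ` V"
  proof -
    have "f ` B \<subseteq> insert 0 (f ` C)" using A by (auto simp: C_def K_def)
    then have "vs2.span (f ` B) \<subseteq> vs2.span (f ` C)"
      by (metis vs2.span_mono vs2.span_insert_0)
    moreover have "vs2.span (f ` C) \<subseteq> vs2.span (f ` B)"
      by (intro vs2.span_mono) (auto simp: C_def)
    ultimately show ?thesis using f.span_image[of B] spanB by auto
  qed
  have finC: "finite C" using finB by (simp add: C_def)
  show "vs2.fin_dim (f ` V)"
    using finC spanfC f.subspace_image[OF Vs] by (auto simp: vs2.fin_dim_def)
  have "vs2.dim (f ` V) = card (f ` C)"
    using vs2.dim_span_eq_card_independent[OF indfC] spanfC by simp
  also have "\<dots> = card C"
    using inj vs1.span_superset by (intro card_image) (auto intro: inj_on_subset)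
  also have "\<dots> = card B - card A"
    unfolding C_def using A B by (intro card_Diff_subset) auto
  finally show "vs1.dim V = vs1.dim {v \<in> V. f v = 0} + vs2.dim (f ` V)"
    using cardB A(5) card_mono[OF finB B(1)] by (simp add: K_def)
qed

text \<open>Generators of the kernel together with preimages of a basis of the image span
  \<open>V\<close>. This serves spaces, such as the forms of a given degree, for which no finite
  spanning set is at hand.\<close>

lemma fin_dim_kernel_image:
  assumes lin: "Vector_Spaces.linear s1 s2 f" and V: "vs1.subspace V"
    and K: "vs1.fin_dim {v \<in> V. f v = 0}" and I: "vs2.fin_dim (f ` V)"
  shows "vs1.fin_dim V"
proof -
  interpret f: Vector_Spaces.linear s1 s2 f by fact
  obtain A where A: "finite A" "{v \<in> V. f v = 0} \<subseteq> vs1.span A"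
    using K by (auto simp: vs1.fin_dim_def)
  obtain B where B: "finite B" "B \<subseteq> f ` V" "vs2.span B = f ` V"
    using vs2.fin_dim_basis[OF I] by metis
  obtain C where C: "finite C" "C \<subseteq> V" "B = f ` C"
    using B by (meson finite_subset_image)
  have "V \<subseteq> vs1.span (A \<union> C)"
  proof
    fix v assume v: "v \<in> V"
    then have "f v \<in> f ` vs1.span C" using B(3) C(3) f.span_image[of C] by auto
    then obtain w where w: "w \<in> vs1.span C" "f v = f w" by auto
    have "w \<in> V" using w(1) C(2) V by (meson subsetD vs1.span_minimal)
    then have "v - w \<in> {v \<in> V. f v = 0}"
      using v w V by (auto simp: f.diff vs1.subspace_diff)
    then have "v - w \<in> vs1.span (A \<union> C)"
      using A(2) vs1.span_mono[of A "A \<union> C"] by auto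
    moreover have "w \<in> vs1.span (A \<union> C)"
      using w(1) vs1.span_mono[of C "A \<union> C"] by auto
    ultimately show "v \<in> vs1.span (A \<union> C)"
      using vs1.span_add by fastforce
  qed
  then show ?thesis using V A(1) C(1) by (auto simp: vs1.fin_dim_def intro!: exI[of _ "A \<union> C"])
qed

lemma dim_image_inj:
  assumes lin: "Vector_Spaces.linear s1 s2 f" and inj: "\<And>v. v \<in> V \<Longrightarrow> f v = 0 \<Longrightarrow> v = 0"
    and V: "vs1.fin_dim V"
  shows "vs2.dim (f ` V) = vs1.dim V"
proof -
  interpret f: Vector_Spaces.linear s1 s2 f by fact
  have "{v \<in> V. f v = 0} = {0}"
    using inj V vs1.subspace_0 by (auto simp: vs1.fin_dim_def)
  then show ?thesis using rank_nullity(2)[OF lin V] by simp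
qed

end

section \<open>The polynomial ring in three variables\<close>

lemma const_hom [simp]: "const 0 = 0" "const 1 = 1" "const (a + b) = const a + const b"
  "const (a * b) = const a * const b"
  by (simp_all add: const_def single_add mult_single)

lemma poly_mapping_sum_monomials:
  "(\<Sum>m\<in>Poly_Mapping.keys p. Poly_Mapping.single m (Poly_Mapping.lookup p m)) = p"
  by (intro poly_mapping_eqI) (auto simp: lookup_sum lookup_single when_def in_keys_iff)

lemma S_monomial_induct [case_names single add]:
  fixes p :: S
  assumes single: "\<And>m c. P (Poly_Mapping.single m c)"
    and add: "\<And>p q. P p \<Longrightarrow> P q \<Longrightarrow> P (p + q)"
  shows "P p"
proof -
  have "P (\<Sum>m\<in>A. Poly_Mapping.single m (Poly_Mapping.lookup p m))" if "finite A" for A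
    using that
  proof (induction A rule: finite_induct)
    case empty
    show ?case using single[of 0 0] by simp
  qed (auto intro: single add)
  from this[OF finite_keys, of p] show ?thesis
    by (simp add: poly_mapping_sum_monomials)
qed

text \<open>The additive extension of a map given on monomials. Differentiation, projection to a
  degree and restriction to a line all have this shape, so additivity is proved once. The condition
  \<open>F m 0 = 0\<close> in the lemmas makes the sum independent of the chosen support.\<close>

definition mon_ext :: "((3 \<Rightarrow>\<^sub>0 nat) \<Rightarrow> complex \<Rightarrow> 'b::comm_monoid_add) \<Rightarrow> S \<Rightarrow> 'b" where
  "mon_ext F p = (\<Sum>m\<in>Poly_Mapping.keys p. F m (Poly_Mapping.lookup p m))"

lemma mon_ext_superset:
  assumes "finite A" "Poly_Mapping.keys p \<subseteq> A" "\<And>m. F m 0 = 0"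
  shows "mon_ext F p = (\<Sum>m\<in>A. F m (Poly_Mapping.lookup p m))"
  unfolding mon_ext_def using assms
  by (intro sum.mono_neutral_left) (auto simp: not_in_keys_iff_lookup_eq_zero)

lemma mon_ext_single:
  assumes "\<And>m. F m 0 = 0"
  shows "mon_ext F (Poly_Mapping.single m c) = F m c"
  using mon_ext_superset[of "{m}" "Poly_Mapping.single m c" F] assms by simp

lemma mon_ext_add:
  assumes "\<And>m. F m 0 = 0" "\<And>m a b. F m (a + b) = F m a + F m b"
  shows "mon_ext F (p + q) = mon_ext F p + mon_ext F q"
proof -
  define A where "A = Poly_Mapping.keys p \<union> Poly_Mapping.keys q"
  have A: "finite A" "Poly_Mapping.keys p \<subseteq> A" "Poly_Mapping.keys q \<subseteq> A"
    "Poly_Mapping.keys (p + q) \<subseteq> A"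
    using keys_add[of p q] by (auto simp: A_def)
  show ?thesis
    using mon_ext_superset[OF A(1,2), of F] mon_ext_superset[OF A(1,3), of F]
      mon_ext_superset[OF A(1,4), of F] assms
    by (simp add: lookup_add sum.distrib)
qed

subsection \<open>Partial derivatives\<close>

lemma partial_mon_ext: "partial i = mon_ext (\<lambda>m c.
    Poly_Mapping.single (m - Poly_Mapping.single i 1) (of_nat (Poly_Mapping.lookup m i) * c))"
  by (simp add: fun_eq_iff partial_def mon_ext_def)

lemma partial_single: "partial i (Poly_Mapping.single m c) =
    Poly_Mapping.single (m - Poly_Mapping.single i 1) (of_nat (Poly_Mapping.lookup m i) * c)"
  unfolding partial_mon_ext by (subst mon_ext_single) auto

lemma partial_add: "partial i (p + q) = partial i p + partial i q"
  unfolding partial_mon_ext by (subst mon_ext_add) (auto simp: single_add algebra_simps)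

lemma partial_mult: "partial i (p * q) = partial i p * q + p * partial i q"
proof (induction p rule: S_monomial_induct)
  case (single m c)
  show ?case
  proof (induction q rule: S_monomial_induct)
    case (single n b)
    define e where "e = Poly_Mapping.single i (1::nat)"
    \<comment> \<open>Subtraction of exponents is truncated, so the two monomials can differ when
      the variable does not occur in \<open>k\<close>; then both coefficients are zero.\<close>
    have *: "Poly_Mapping.single (k + n - e) (of_nat (Poly_Mapping.lookup k i) * x) =
        Poly_Mapping.single (k - e + n) (of_nat (Poly_Mapping.lookup k i) * x)" for k n and x :: complex
    proof (cases "Poly_Mapping.lookup k i = 0")
      case False
      have "k + n - e = k - e + n"
        using False
        by (intro poly_mapping_eqI) (auto simp: e_def lookup_minus lookup_add lookup_single when_def)
      then show ?thesis by simp
    qed simp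
    have "partial i (Poly_Mapping.single m c * Poly_Mapping.single n b) =
      Poly_Mapping.single (m + n - e) (of_nat (Poly_Mapping.lookup m i) * (c * b)) +
      Poly_Mapping.single (n + m - e) (of_nat (Poly_Mapping.lookup n i) * (c * b))"
      by (simp add: mult_single partial_single e_def lookup_add algebra_simps flip: single_add)
    then show ?case
      by (simp only: *) (simp add: partial_single mult_single e_def algebra_simps)
  qed (simp add: partial_add distrib_left add_ac)
qed (simp add: partial_add distrib_right add_ac)

lemma partial_const [simp]: "partial i (const c) = 0"
  by (simp add: const_def partial_single)

lemma partial_0 [simp]: "partial i 0 = 0"
  using partial_const[of i 0] by simp

lemma partial_1 [simp]: "partial i 1 = 0"
  using partial_const[of i 1] by simp

lemma partial_var: "partial i (var j) = (if i = j then 1 else 0)"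
proof (cases "i = j")
  case True
  have "Poly_Mapping.single j (Suc 0) - Poly_Mapping.single j (Suc 0) = 0"
    by (intro poly_mapping_eqI) (simp add: lookup_minus)
  with True show ?thesis by (simp add: var_def partial_single)
qed (simp add: var_def partial_single lookup_single)

lemma partial_sum: "partial i (sum g A) = (\<Sum>x\<in>A. partial i (g x))"
  by (induction A rule: infinite_finite_induct) (auto simp: partial_add)

subsection \<open>Homogeneous polynomials\<close>

lemma mon_degree_add: "mon_degree (m + n) = mon_degree m + mon_degree n"
  by (simp add: mon_degree_def lookup_add sum.distrib)

lemma mon_degree_single [simp]: "mon_degree (Poly_Mapping.single i k) = k"
  by (simp add: mon_degree_def lookup_single when_def)

lemma mon_degree_0 [simp]: "mon_degree 0 = 0"
  by (simp add: mon_degree_def)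

lemma homogeneous_0 [simp]: "homogeneous n 0"
  by (simp add: homogeneous_def)

lemma homogeneous_single: "int (mon_degree m) = n \<Longrightarrow> homogeneous n (Poly_Mapping.single m c)"
  by (auto simp: homogeneous_def)

lemma homogeneous_const [simp]: "homogeneous 0 (const c)"
  by (simp add: const_def homogeneous_single)

lemma homogeneous_1 [simp]: "homogeneous 0 1"
  using homogeneous_const[of 1] by simp

lemma homogeneous_var [simp]: "homogeneous 1 (var i)"
  by (simp add: var_def homogeneous_single)

lemma homogeneous_add: "homogeneous n p \<Longrightarrow> homogeneous n q \<Longrightarrow> homogeneous n (p + q)"
  unfolding homogeneous_def using keys_add[of p q] by blast

lemma homogeneous_minus: "homogeneous n p \<Longrightarrow> homogeneous n (- p)"
  by (simp add: homogeneous_def)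

lemma homogeneous_diff: "homogeneous n p \<Longrightarrow> homogeneous n q \<Longrightarrow> homogeneous n (p - q)"
  using homogeneous_add[of n p "- q"] by (simp add: homogeneous_minus)

lemma homogeneous_sum: "(\<And>x. x \<in> A \<Longrightarrow> homogeneous n (g x)) \<Longrightarrow> homogeneous n (sum g A)"
  by (induction A rule: infinite_finite_induct) (auto intro: homogeneous_add)

lemma homogeneous_mult:
  assumes "homogeneous n p" "homogeneous k q"
  shows "homogeneous (n + k) (p * q)"
  using assms keys_mult[of p q] by (force simp: homogeneous_def mon_degree_add)

lemma homogeneous_mult_eq:
  "homogeneous n p \<Longrightarrow> homogeneous k q \<Longrightarrow> n + k = l \<Longrightarrow> homogeneous l (p * q)"
  using homogeneous_mult by blast

lemma homogeneous_const_mult: "homogeneous n p \<Longrightarrow> homogeneous n (const c * p)"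
  using homogeneous_mult[OF homogeneous_const] by force

lemma homogeneous_prod:
  assumes "\<And>x. x \<in> A \<Longrightarrow> homogeneous 1 (g x)"
  shows "homogeneous (int (card A)) (prod g A)"
  using assms
  by (induction A rule: infinite_finite_induct) (auto intro: homogeneous_mult)

lemma homogeneous_neg: "homogeneous n p \<Longrightarrow> n < 0 \<Longrightarrow> p = 0"
  by (auto simp: homogeneous_def)

text \<open>Every monomial of positive degree contains a variable, which can be split off. This
  drives the inductions on the degree for restriction to a line.\<close>

lemma homogeneous_induct [consumes 1, case_names const add var]:
  assumes "homogeneous (int n) p"
    and const: "\<And>c. P 0 (const c)"
    and add: "\<And>n p q. homogeneous (int n) p \<Longrightarrow> homogeneous (int n) q \<Longrightarrow> P n p \<Longrightarrow> P n q \<Longrightarrow> P n (p + q)"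
    and var: "\<And>n p i. homogeneous (int n) p \<Longrightarrow> P n p \<Longrightarrow> P (Suc n) (var i * p)"
  shows "P n p"
proof -
  have mono: "P n (Poly_Mapping.single m c)" if "mon_degree m = n" for m c n
    using that
  proof (induction n arbitrary: m)
    case 0
    then have "m = 0" by (intro poly_mapping_eqI) (simp add: mon_degree_def)
    then show ?case using const by (simp add: const_def)
  next
    case (Suc n)
    obtain i where i: "Poly_Mapping.lookup m i \<noteq> 0"
      using Suc(2) unfolding mon_degree_def by fastforce
    define m' where "m' = m - Poly_Mapping.single i 1"
    have m: "m = Poly_Mapping.single i 1 + m'"
      using i by (intro poly_mapping_eqI) (auto simp: m'_def lookup_add lookup_minus lookup_single when_def)
    have m': "mon_degree m' = n"
      using Suc(2) by (simp add: m mon_degree_add)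
    have "Poly_Mapping.single m c = var i * Poly_Mapping.single m' c"
      by (simp add: m var_def mult_single)
    then show ?case
      using var[OF homogeneous_single Suc.IH[OF m']] m' by simp
  qed
  \<comment> \<open>In positive degree no base case covers 0; it is reached as a monomial with
    coefficient 0.\<close>
  have zero: "P n 0"
    using mono[of "Poly_Mapping.single undefined n" n 0] by simp
  have "P n (\<Sum>m\<in>A. Poly_Mapping.single m (Poly_Mapping.lookup p m)) \<and>
      homogeneous (int n) (\<Sum>m\<in>A. Poly_Mapping.single m (Poly_Mapping.lookup p m))"
    if "finite A" "A \<subseteq> Poly_Mapping.keys p" for A
    using that
  proof (induction A rule: finite_induct)
    case (insert m A)
    have "mon_degree m = n" using insert.prems assms(1) by (auto simp: homogeneous_def)
    then show ?case
      using insert by (auto intro!: add mono homogeneous_add homogeneous_single)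
  qed (simp add: zero)
  from this[OF finite_keys subset_refl] show ?thesis
    by (simp add: poly_mapping_sum_monomials)
qed

definition hom_part :: "int \<Rightarrow> S \<Rightarrow> S" where
  "hom_part n = mon_ext (\<lambda>m c. if int (mon_degree m) = n then Poly_Mapping.single m c else 0)"

lemma hom_part_add: "hom_part n (p + q) = hom_part n p + hom_part n q"
  unfolding hom_part_def by (subst mon_ext_add) (auto simp: single_add)

lemma hom_part_0 [simp]: "hom_part n 0 = 0"
  by (simp add: hom_part_def mon_ext_def)

lemma hom_part_sum: "hom_part n (sum g A) = (\<Sum>x\<in>A. hom_part n (g x))"
  by (induction A rule: infinite_finite_induct) (auto simp: hom_part_add)

lemma homogeneous_hom_part [simp]: "homogeneous n (hom_part n p)"
  unfolding hom_part_def mon_ext_def by (intro homogeneous_sum) (auto intro: homogeneous_single)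

lemma hom_part_single: "hom_part n (Poly_Mapping.single m c) =
    (if int (mon_degree m) = n then Poly_Mapping.single m c else 0)"
  unfolding hom_part_def by (subst mon_ext_single) auto

lemma hom_part_homogeneous: "homogeneous n p \<Longrightarrow> hom_part n p = p"
  by (simp add: hom_part_def mon_ext_def homogeneous_def poly_mapping_sum_monomials cong: sum.cong)

text \<open>Multiplication by a form shifts the grading, hence commutes with the projections up to
  that shift. Thus solutions of linear equations with homogeneous data can be replaced by
  homogeneous ones.\<close>

lemma hom_part_mult:
  assumes "homogeneous k a"
  shows "hom_part n (a * p) = a * hom_part (n - k) p"
proof (induction p rule: S_monomial_induct)
  case (single m c)
  show ?case
  proof (cases "int (mon_degree m) = n - k")
    case True
    then have "homogeneous n (a * Poly_Mapping.single m c)"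
      using homogeneous_mult[OF assms homogeneous_single[OF True]] by simp
    then show ?thesis using True by (simp add: hom_part_single hom_part_homogeneous)
  next
    case False
    have "homogeneous (k + int (mon_degree m)) (a * Poly_Mapping.single m c)"
      using assms by (intro homogeneous_mult homogeneous_single) auto
    then have "hom_part n (a * Poly_Mapping.single m c) = 0"
      unfolding hom_part_def mon_ext_def homogeneous_def using False by (intro sum.neutral) auto
    then show ?thesis using False by (simp add: hom_part_single)
  qed
qed (simp_all add: hom_part_add distrib_left)

section \<open>Dimensions of spaces of forms\<close>

interpretation S_vs: vector_space "\<lambda>c p. const c * p :: S"
  by unfold_locales (simp_all only: const_hom distrib_left distrib_right mult.assoc mult_1_left)

interpretation S3_vs: vector_space "\<lambda>c v. const c *s v :: S ^ 3"
  by unfold_locales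
    (simp_all only: const_hom vector_add_ldistrib vector_sadd_rdistrib vector_smult_assoc vector_smult_lid)

interpretation poly_vs: vector_space "Polynomial.smult :: complex \<Rightarrow> complex poly \<Rightarrow> complex poly"
  by unfold_locales (simp_all only: smult_add_right smult_add_left smult_smult smult_1_left)

interpretation S_S: vector_space_pair "\<lambda>c p. const c * p :: S" "\<lambda>c p. const c * p :: S" ..
interpretation S_S3: vector_space_pair "\<lambda>c p. const c * p :: S" "\<lambda>c v. const c *s v :: S ^ 3" ..
interpretation S3_S: vector_space_pair "\<lambda>c v. const c *s v :: S ^ 3" "\<lambda>c p. const c * p :: S" ..
interpretation S3_S3: vector_space_pair "\<lambda>c v. const c *s v :: S ^ 3" "\<lambda>c v. const c *s v :: S ^ 3" ..
interpretation S_poly: vector_space_pair "\<lambda>c p. const c * p :: S"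
  "Polynomial.smult :: complex \<Rightarrow> complex poly \<Rightarrow> complex poly" ..
interpretation S3_poly: vector_space_pair "\<lambda>c v. const c *s v :: S ^ 3"
  "Polynomial.smult :: complex \<Rightarrow> complex poly \<Rightarrow> complex poly" ..
interpretation poly_poly: vector_space_pair
  "Polynomial.smult :: complex \<Rightarrow> complex poly \<Rightarrow> complex poly"
  "Polynomial.smult :: complex \<Rightarrow> complex poly \<Rightarrow> complex poly" ..

text \<open>As rewrite rules these loop with \<open>mult.assoc\<close>.\<close>

declare S_ideal.scale_scale [simp del] S_vs.scale_scale [simp del]

text \<open>Indexed by the dimension and not by a degree bound, so that the zero space is the case
  \<open>N = 0\<close> and needs no convention for the degree of 0.\<close>

definition poly_below :: "nat \<Rightarrow> complex poly set" where
  "poly_below N = {p. \<forall>i\<ge>N. coeff p i = 0}"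

lemma poly_below_subspace: "poly_vs.subspace (poly_below N)"
  by (auto simp: poly_vs.subspace_def poly_below_def)

lemma poly_below_0 [simp]: "poly_below 0 = {0}"
  by (auto simp: poly_below_def poly_eq_iff)

lemma poly_below_iff: "p \<in> poly_below N \<longleftrightarrow> p = 0 \<or> Polynomial.degree p < N"
proof
  show "p = 0 \<or> Polynomial.degree p < N" if "p \<in> poly_below N"
  proof (rule ccontr)
    assume "\<not> (p = 0 \<or> Polynomial.degree p < N)"
    then have "p \<noteq> 0" "coeff p (Polynomial.degree p) = 0"
      using that by (auto simp: poly_below_def)
    then show False by simp
  qed
qed (auto simp: poly_below_def intro: coeff_eq_0)

lemma dim_poly_below: "poly_vs.fin_dim (poly_below N) \<and> poly_vs.dim (poly_below N) = N"
proof (induction N)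
  case (Suc N)
  define f :: "complex poly \<Rightarrow> complex poly" where "f p = monom (coeff p N) N" for p
  have lin: "Vector_Spaces.linear Polynomial.smult Polynomial.smult f"
    by unfold_locales (simp_all add: f_def add_monom smult_monom)
  have ker: "{p \<in> poly_below (Suc N). f p = 0} = poly_below N"
  proof (intro subset_antisym subsetI)
    fix p assume p: "p \<in> {p \<in> poly_below (Suc N). f p = 0}"
    have "coeff p i = 0" if "i \<ge> N" for i
      using p that by (cases "i = N") (simp_all add: f_def poly_below_def)
    then show "p \<in> poly_below N" by (simp add: poly_below_def)
  qed (simp add: f_def poly_below_def)
  have im: "f ` poly_below (Suc N) = poly_vs.span {monom 1 N}"
  proof -
    have "f p \<in> poly_vs.span {monom 1 N}" for p
      unfolding poly_vs.span_singleton f_def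
      by (rule range_eqI[of _ _ "coeff p N"]) (simp add: smult_monom)
    moreover have "Polynomial.smult c (monom 1 N) \<in> f ` poly_below (Suc N)" for c
      by (rule image_eqI[of _ _ "monom c N"]) (auto simp: f_def smult_monom poly_below_def)
    ultimately show ?thesis by (auto simp: poly_vs.span_singleton)
  qed
  have fin: "poly_vs.fin_dim (f ` poly_below (Suc N))"
    unfolding im poly_vs.fin_dim_def by (auto intro!: exI[of _ "{monom 1 N}"])
  have "monom 1 N \<noteq> (0 :: complex poly)" by simp
  then have "poly_vs.dim (f ` poly_below (Suc N)) = 1"
    unfolding im by (subst poly_vs.dim_span_eq_card_independent) auto
  moreover have "poly_vs.fin_dim (poly_below (Suc N))"
    using poly_poly.fin_dim_kernel_image[OF lin poly_below_subspace, of "Suc N"] fin Suc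
    by (simp add: ker)
  ultimately show ?case
    using poly_poly.rank_nullity(2)[OF lin, of "poly_below (Suc N)"] Suc
    by (simp add: ker)
qed simp

section \<open>Dot and cross products, linear forms\<close>

definition dot :: "'a::comm_ring_1 ^ 3 \<Rightarrow> 'a ^ 3 \<Rightarrow> 'a" where
  "dot a b = (\<Sum>i\<in>UNIV. vec_nth a i * vec_nth b i)"

definition cross :: "'a::comm_ring_1 ^ 3 \<Rightarrow> 'a ^ 3 \<Rightarrow> 'a ^ 3" where
  "cross a b = vector [vec_nth a 2 * vec_nth b 3 - vec_nth a 3 * vec_nth b 2,
                       vec_nth a 3 * vec_nth b 1 - vec_nth a 1 * vec_nth b 3,
                       vec_nth a 1 * vec_nth b 2 - vec_nth a 2 * vec_nth b 1]"

lemma cross_nth [simp]: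
  "vec_nth (cross a b) 1 = vec_nth a 2 * vec_nth b 3 - vec_nth a 3 * vec_nth b 2"
  "vec_nth (cross a b) 2 = vec_nth a 3 * vec_nth b 1 - vec_nth a 1 * vec_nth b 3"
  "vec_nth (cross a b) 3 = vec_nth a 1 * vec_nth b 2 - vec_nth a 2 * vec_nth b 1"
  by (simp_all add: cross_def)

lemma dot_add_right: "dot a (b + c) = dot a b + dot a c"
  by (simp add: dot_def algebra_simps sum.distrib)
lemma dot_add_left: "dot (a + b) c = dot a c + dot b c"
  by (simp add: dot_def algebra_simps sum.distrib)
lemma dot_scale_right: "dot a (c *s b) = c * dot a b"
  by (simp add: dot_def algebra_simps sum_distrib_left)
lemma dot_scale_left: "dot (c *s a) b = c * dot a b"
  by (simp add: dot_def algebra_simps sum_distrib_left)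
lemma dot_0 [simp]: "dot 0 b = 0" "dot a 0 = 0"
  by (simp_all add: dot_def)
lemma dot_diff_right: "dot a (b - c) = dot a b - dot a c"
  by (simp add: dot_def algebra_simps sum_subtractf)
lemma dot_diff_left: "dot (a - b) c = dot a c - dot b c"
  by (simp add: dot_def algebra_simps sum_subtractf)
lemma dot_sum_left: "dot (\<Sum>x\<in>A. g x) b = (\<Sum>x\<in>A. dot (g x) b)"
  by (induction A rule: infinite_finite_induct) (auto simp: dot_add_left)

definition cvec :: "complex ^ 3 \<Rightarrow> S ^ 3" where
  "cvec a = vec_lambda (\<lambda>i. const (vec_nth a i))"

lemma cvec_nth [simp]: "vec_nth (cvec a) i = const (vec_nth a i)"
  by (simp add: cvec_def)

lemma linear_form_dot: "linear_form a = dot (cvec a) (vec_lambda var)"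
  by (simp add: linear_form_def dot_def)

lemma zeros_linear_form_dot: "zeros_linear_form a = {v. dot a v = 0}"
  by (simp add: zeros_linear_form_def dot_def)

lemma homogeneous_linear_form [simp]: "homogeneous 1 (linear_form a)"
  unfolding linear_form_def by (intro homogeneous_sum homogeneous_const_mult) simp

subsection \<open>Restriction to a line\<close>

text \<open>The form \<open>p\<close> along the affine line \<open>u + t v\<close>, as a polynomial in \<open>t\<close>.\<close>

definition line_res :: "complex ^ 3 \<Rightarrow> complex ^ 3 \<Rightarrow> S \<Rightarrow> complex poly" where
  "line_res u v = mon_ext (\<lambda>m c.
     Polynomial.smult c (\<Prod>i\<in>UNIV. [:vec_nth u i, vec_nth v i:] ^ Poly_Mapping.lookup m i))"

lemma line_res_single: "line_res u v (Poly_Mapping.single m c) =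
    Polynomial.smult c (\<Prod>i\<in>UNIV. [:vec_nth u i, vec_nth v i:] ^ Poly_Mapping.lookup m i)"
  unfolding line_res_def by (subst mon_ext_single) auto

lemma line_res_add: "line_res u v (p + q) = line_res u v p + line_res u v q"
  unfolding line_res_def by (subst mon_ext_add) (auto simp: smult_add_left)

lemma line_res_mult: "line_res u v (p * q) = line_res u v p * line_res u v q"
proof (induction p rule: S_monomial_induct)
  case (single m c)
  show ?case
  proof (induction q rule: S_monomial_induct)
    case (single n b)
    show ?case
      by (simp add: mult_single line_res_single lookup_add power_add prod.distrib mult_ac)
  next
    case (add p q)
    then show ?case by (simp only: distrib_left line_res_add)
  qed
next
  case (add p q)
  then show ?case by (simp only: distrib_right line_res_add)
qed

lemma line_res_const [simp]: "line_res u v (const c) = [:c:]"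
  by (simp add: const_def line_res_single)

lemma line_res_var [simp]: "line_res u v (var i) = [:vec_nth u i, vec_nth v i:]"
proof -
  have "(\<Prod>j\<in>UNIV. [:vec_nth u j, vec_nth v j:] ^ Poly_Mapping.lookup (Poly_Mapping.single i 1) j) =
    (\<Prod>j\<in>UNIV. if j = i then [:vec_nth u i, vec_nth v i:] else 1)"
    by (intro prod.cong) (auto simp: lookup_single)
  then show ?thesis by (simp add: var_def line_res_single)
qed

lemma line_res_0 [simp]: "line_res u v 0 = 0"
  using line_res_const[of u v 0] by simp

lemma line_res_1 [simp]: "line_res u v 1 = 1"
  using line_res_const[of u v 1] by (simp add: one_pCons)

lemma line_res_minus: "line_res u v (- p) = - line_res u v p"
  using line_res_add[of u v p "- p"] by (metis add.right_inverse eq_neg_iff_add_eq_0 line_res_0 add.commute)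

lemma line_res_diff: "line_res u v (p - q) = line_res u v p - line_res u v q"
  using line_res_add[of u v p "- q"] by (simp add: line_res_minus)

lemma line_res_sum: "line_res u v (sum g A) = (\<Sum>x\<in>A. line_res u v (g x))"
  by (induction A rule: infinite_finite_induct) (auto simp: line_res_add)

lemma line_res_prod: "line_res u v (prod g A) = (\<Prod>x\<in>A. line_res u v (g x))"
  by (induction A rule: infinite_finite_induct) (auto simp: line_res_mult)

lemma line_res_power: "line_res u v (p ^ n) = line_res u v p ^ n"
  by (induction n) (auto simp: line_res_mult)

lemma line_res_linear_form [simp]: "line_res u v (linear_form a) = [:dot a u, dot a v:]"
proof -
  show ?thesis
    by (simp add: linear_form_def dot_def sum_3 line_res_add line_res_mult)
qed

lemma linear_line_res: "Vector_Spaces.linear (\<lambda>c p. const c * p) Polynomial.smult (line_res u v)"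
  by unfold_locales (simp_all add: line_res_add line_res_mult)

lemma line_res_below:
  assumes "homogeneous k p"
  shows "line_res u v p \<in> poly_below (nat (k + 1))"
proof (cases "k < 0")
  case True
  then show ?thesis using homogeneous_neg[OF assms] by (simp add: poly_below_def)
next
  case False
  then obtain n where k: "k = int n" by (metis nonneg_int_cases not_le)
  have "line_res u v p \<in> poly_below (Suc n)"
    using assms unfolding k
  proof (induction n p rule: homogeneous_induct)
    case (var n p i)
    then show ?case
      by (auto simp: poly_below_def line_res_mult coeff_pCons split: nat.splits)
  qed (auto simp: poly_below_def line_res_add coeff_pCons split: nat.splits)
  then show ?thesis by (simp add: k nat_add_distrib)
qed

text \<open>
  A line \<open>a = 0\<close> with a basis \<open>u, v\<close>, completed to a basis \<open>u, v, w\<close> of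
  \<open>\<complex>\<^sup>3\<close> whose dual basis is \<open>\<mu>, \<nu>, a\<close>.
\<close>

locale line_frame =
  fixes a u v w \<mu> \<nu> :: "complex ^ 3"
  assumes a_u: "dot a u = 0" and a_v: "dot a v = 0"
    and \<mu>_u: "dot \<mu> u = 1" and \<mu>_v: "dot \<mu> v = 0" and \<nu>_u: "dot \<nu> u = 0" and \<nu>_v: "dot \<nu> v = 1"
    and a_w: "dot a w = 1" and cross_uv: "cross u v = a"
    and unit: "\<And>i j. vec_nth \<mu> j * vec_nth u i + vec_nth \<nu> j * vec_nth v i + vec_nth a j * vec_nth w i =
      (if i = j then 1 else 0)"
begin

text \<open>The homogenization of \<open>g\<close> in degree \<open>n\<close>, written in \<mu> and
  \<nu>, which restrict to 1 and t on the line. It is a section of the restriction map.\<close>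

definition lift_form :: "nat \<Rightarrow> complex poly \<Rightarrow> S" where
  "lift_form n g = (\<Sum>j\<le>n. const (coeff g j) * linear_form \<mu> ^ (n - j) * linear_form \<nu> ^ j)"

lemma homogeneous_linear_form_power: "homogeneous (int n) (linear_form b ^ n)"
  by (induction n) (auto intro: homogeneous_mult)

lemma homogeneous_lift_form: "homogeneous (int n) (lift_form n g)"
  unfolding lift_form_def
proof (intro homogeneous_sum)
  fix j assume "j \<in> {..n}"
  then have n: "int n = 0 + int (n - j) + int j" by auto
  show "homogeneous (int n) (const (coeff g j) * linear_form \<mu> ^ (n - j) * linear_form \<nu> ^ j)"
    unfolding n by (intro homogeneous_mult homogeneous_const homogeneous_linear_form_power)
qed

lemma lift_form_add: "lift_form n (g + h) = lift_form n g + lift_form n h"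
  by (simp add: lift_form_def algebra_simps sum.distrib)

lemma line_res_lift_form:
  assumes "g \<in> poly_below (Suc n)"
  shows "line_res u v (lift_form n g) = g"
proof -
  have 1: "line_res u v (linear_form \<mu>) = 1" "line_res u v (linear_form \<nu>) = monom 1 1"
    by (simp_all add: \<mu>_u \<mu>_v \<nu>_u \<nu>_v monom_altdef)
  have "line_res u v (lift_form n g) = (\<Sum>j\<le>n. monom (coeff g j) j)"
    by (simp add: lift_form_def line_res_sum line_res_mult line_res_power 1 monom_power smult_monom
        del: line_res_linear_form)
  also have "\<dots> = g"
  proof (rule poly_eqI)
    fix i show "coeff (\<Sum>j\<le>n. monom (coeff g j) j) i = coeff g i"
      using assms by (auto simp: coeff_sum poly_below_def not_le)
  qed
  finally show ?thesis .
qed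

lemma var_decomp: "var i = const (vec_nth u i) * linear_form \<mu> + const (vec_nth v i) * linear_form \<nu>
    + const (vec_nth w i) * linear_form a"
proof -
  have "const (vec_nth u i) * linear_form \<mu> + const (vec_nth v i) * linear_form \<nu>
    + const (vec_nth w i) * linear_form a =
    (\<Sum>j\<in>UNIV. const (vec_nth \<mu> j * vec_nth u i + vec_nth \<nu> j * vec_nth v i + vec_nth a j * vec_nth w i) * var j)"
    by (simp add: linear_form_def sum_distrib_left sum.distrib algebra_simps)
  also have "\<dots> = (\<Sum>j\<in>UNIV. if i = j then var j else 0)"
    unfolding unit by (intro sum.cong) auto
  finally show ?thesis by simp
qed

text \<open>Since \<open>[:c, e:]\<close> is the restriction of c \<mu> + e \<nu>, this is
  multiplicativity of homogenization. The bound on \<open>g\<close> ensures that the sums, cut off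
  at \<open>n\<close>, lose no coefficient.\<close>

lemma lift_form_pCons:
  assumes "g \<in> poly_below (Suc n)"
  shows "lift_form (Suc n) ([:c, e:] * g) = (const c * linear_form \<mu> + const e * linear_form \<nu>) * lift_form n g"
proof -
  let ?M = "linear_form \<mu>" and ?N = "linear_form \<nu>"
  have top: "coeff g (Suc n) = 0" using assms by (simp add: poly_below_def)
  have "lift_form (Suc n) ([:c, e:] * g) =
     lift_form (Suc n) (Polynomial.smult c g) + lift_form (Suc n) (pCons 0 (Polynomial.smult e g))"
    by (simp flip: lift_form_add)
  also have "lift_form (Suc n) (Polynomial.smult c g) = const c * ?M * lift_form n g"
    unfolding lift_form_def by (simp add: top sum_distrib_left Suc_diff_le algebra_simps)
  also have "lift_form (Suc n) (pCons 0 (Polynomial.smult e g)) = const e * ?N * lift_form n g"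
    unfolding lift_form_def
    by (subst sum.atMost_Suc_shift) (simp add: sum_distrib_left algebra_simps)
  finally show ?thesis by (simp add: algebra_simps)
qed

text \<open>Division by the linear form \<open>a\<close>, with a remainder in \<mu> and \<nu> alone.
  A variable is, modulo \<open>a\<close>, a combination of \<mu> and \<nu>, so the division passes
  from one degree to the next. It identifies the kernel of restriction with the multiples of
  \<open>a\<close>.\<close>

lemma line_res_decomp:
  assumes "homogeneous (int n) p"
  shows "\<exists>q. homogeneous (int n - 1) q \<and> p = lift_form n (line_res u v p) + linear_form a * q"
  using assms
proof (induction n p rule: homogeneous_induct)
  case (const c)
  then show ?case by (intro exI[of _ 0]) (simp add: lift_form_def)
next
  case (add n p q)
  then obtain p' q' where "homogeneous (int n - 1) p'" "p = lift_form n (line_res u v p) + linear_form a * p'"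
    "homogeneous (int n - 1) q'" "q = lift_form n (line_res u v q) + linear_form a * q'"
    by blast
  then show ?case
    by (intro exI[of _ "p' + q'"])
      (auto simp: line_res_add lift_form_add algebra_simps intro: homogeneous_add)
next
  case (var n p i)
  obtain q where q: "homogeneous (int n - 1) q" "p = lift_form n (line_res u v p) + linear_form a * q"
    using var.IH by blast
  have below: "line_res u v p \<in> poly_below (Suc n)"
    using line_res_below[OF var.hyps, of u v] by (simp add: nat_add_distrib)
  define q' where "q' = const (vec_nth w i) * p
    + (const (vec_nth u i) * linear_form \<mu> + const (vec_nth v i) * linear_form \<nu>) * q"
  have "var i * p = (const (vec_nth u i) * linear_form \<mu> + const (vec_nth v i) * linear_form \<nu>) * p
      + linear_form a * (const (vec_nth w i) * p)"
    by (subst var_decomp) (simp add: algebra_simps)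
  also have "\<dots> = (const (vec_nth u i) * linear_form \<mu> + const (vec_nth v i) * linear_form \<nu>) *
      (lift_form n (line_res u v p) + linear_form a * q) + linear_form a * (const (vec_nth w i) * p)"
    using q(2) by simp
  also have "\<dots> = lift_form (Suc n) (line_res u v (var i * p)) + linear_form a * q'"
    unfolding line_res_mult line_res_var lift_form_pCons[OF below] q'_def
    by (simp add: algebra_simps)
  finally have "var i * p = lift_form (Suc n) (line_res u v (var i * p)) + linear_form a * q'" .
  moreover have "homogeneous (int (Suc n) - 1) q'"
    unfolding q'_def using var.hyps q(1)
    by (auto intro!: homogeneous_add homogeneous_const_mult homogeneous_mult_eq[of 1 _ "int n - 1"])
  ultimately show ?case by blast
qed

lemma line_res_eq_0_iff:
  assumes "homogeneous k p"
  shows "line_res u v p = 0 \<longleftrightarrow> (\<exists>q. homogeneous (k - 1) q \<and> p = linear_form a * q)"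
proof
  assume r: "line_res u v p = 0"
  show "\<exists>q. homogeneous (k - 1) q \<and> p = linear_form a * q"
  proof (cases "k < 0")
    case True
    then show ?thesis using homogeneous_neg[OF assms] by (intro exI[of _ 0]) simp
  next
    case False
    then obtain n where k: "k = int n" by (metis nonneg_int_cases not_le)
    show ?thesis using line_res_decomp[of n p] assms r by (simp add: k lift_form_def)
  qed
qed (auto simp: line_res_mult a_u a_v)

lemma dvd_iff_line_res: "homogeneous k p \<Longrightarrow> linear_form a dvd p \<longleftrightarrow> line_res u v p = 0"
  using line_res_eq_0_iff[of k p] by (auto simp: line_res_mult a_u a_v dvd_def)

lemma line_res_image:
  assumes "k \<ge> -1"
  shows "line_res u v ` {p. homogeneous k p} = poly_below (nat (k + 1))"
proof (intro subset_antisym image_subsetI subsetI)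
  fix g assume g: "g \<in> poly_below (nat (k + 1))"
  show "g \<in> line_res u v ` {p. homogeneous k p}"
  proof (cases "k = -1")
    case True
    then show ?thesis using g by (intro image_eqI[of _ _ 0]) auto
  next
    case False
    then have "k \<ge> 0" using assms by linarith
    then obtain n where k: "k = int n" using nonneg_int_cases by blast
    show ?thesis
      using g homogeneous_lift_form[of n g] line_res_lift_form[of g n]
      by (intro image_eqI[of _ _ "lift_form n g"]) (auto simp: k nat_add_distrib)
  qed
qed (use line_res_below in auto)

lemma line_point: "dot a x = 0 \<Longrightarrow> x = dot \<mu> x *s u + dot \<nu> x *s v"
proof -
  assume x: "dot a x = 0"
  have "vec_nth x i = vec_nth (dot \<mu> x *s u + dot \<nu> x *s v) i" for i
  proof -
    have "vec_nth x i = (\<Sum>j\<in>UNIV. (if i = j then 1 else 0) * vec_nth x j)"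
      by (simp add: if_distrib[of "\<lambda>c. c * _"] cong: if_cong)
    also have "\<dots> = vec_nth (dot \<mu> x *s u + dot \<nu> x *s v) i + dot a x * vec_nth w i"
      by (simp add: unit[symmetric] dot_def sum_distrib_left sum_distrib_right sum.distrib algebra_simps)
    finally show ?thesis by (simp add: x)
  qed
  then show ?thesis by (simp add: Finite_Cartesian_Product.vec_eq_iff)
qed

end

lemma dot_axis [simp]: "dot a (axis i c) = vec_nth a i * c" "dot (axis i c) a = c * vec_nth a i"
  by (simp_all add: dot_def axis_def if_distrib if_distribR cong: if_cong)

lemma axis_nth: "vec_nth (axis i c) j = (if j = i then c else 0)"
  by (simp add: axis_def)

text \<open>A vector space over an infinite field is not a finite union of proper subspaces: moving
  along \<open>x\<close>, each form of the set excludes at most one value of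
  \<open>c\<close>.\<close>

lemma exists_avoiding:
  fixes a :: "complex ^ 3"
  assumes "finite F" "\<And>b. b \<in> F \<Longrightarrow> \<exists>x. dot a x = 0 \<and> dot b x \<noteq> 0"
  shows "\<exists>v. dot a v = 0 \<and> (\<forall>b\<in>F. dot b v \<noteq> 0)"
  using assms
proof (induction F rule: finite_induct)
  case (insert b F)
  obtain v where v: "dot a v = 0" "\<forall>b\<in>F. dot b v \<noteq> 0" using insert by auto
  obtain x where x: "dot a x = 0" "dot b x \<noteq> 0" using insert.prems by auto
  have "finite ((\<lambda>b. - dot b v / dot b x) ` insert b F)" using insert.hyps by simp
  then obtain c where c: "c \<notin> (\<lambda>b. - dot b v / dot b x) ` insert b F"
    using infinite_UNIV_char_0 by (metis ex_new_if_finite)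
  have "dot b' (v + c *s x) \<noteq> 0" if "b' \<in> insert b F" for b'
  proof (cases "dot b' x = 0")
    case True
    then show ?thesis using that v x by (auto simp: dot_add_right dot_scale_right)
  next
    case False
    have "c \<noteq> - dot b' v / dot b' x" using c that by blast
    then show ?thesis using False
      by (auto simp: dot_add_right dot_scale_right field_simps add_eq_0_iff)
  qed
  moreover have "dot a (v + c *s x) = 0" using v x by (simp add: dot_add_right dot_scale_right)
  ultimately show ?case by blast
qed (auto intro!: exI[of _ 0])

lemma exists_line_frame:
  fixes a :: "complex ^ 3"
  assumes a: "a \<noteq> 0" and "finite F" "\<And>b. b \<in> F \<Longrightarrow> \<exists>x. dot a x = 0 \<and> dot b x \<noteq> 0"
  obtains u v w \<mu> \<nu> where "line_frame a u v w \<mu> \<nu>" "\<And>b. b \<in> F \<Longrightarrow> dot b v \<noteq> 0"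
proof -
  have e: "\<exists>i. vec_nth x i \<noteq> 0" if "x \<noteq> 0" for x :: "complex ^ 3"
    using that by (auto simp: Finite_Cartesian_Product.vec_eq_iff)
  have dual: "\<exists>y. dot x y = 1" if nz: "x \<noteq> 0" for x :: "complex ^ 3"
  proof -
    obtain i where i: "vec_nth x i \<noteq> 0" using e[OF nz] by auto
    then have "dot x (axis i (1 / vec_nth x i)) = 1"
      using i by simp
    then show ?thesis by blast
  qed
  obtain i where i: "vec_nth a i \<noteq> 0" using e[OF a] by auto
  define j k :: 3 where "j = i + 1" and "k = i + 2"
  have "i = 1 \<or> i = 2 \<or> i = 3" using exhaust_3 by blast
  then have ij: "j \<noteq> i" by (auto simp: j_def)
  define x :: "complex ^ 3" where "x = axis j (vec_nth a i) - axis i (vec_nth a j)"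
  have "dot a x = 0"
    by (simp add: x_def dot_diff_right)
  moreover have "dot (axis j 1) x \<noteq> 0"
    using i ij by (simp add: x_def dot_diff_right axis_nth)
  \<comment> \<open>The extra form \<open>axis j 1\<close> forces \<open>v\<close> to be nonzero
    even when \<open>F\<close> is empty; \<open>x\<close> witnesses that it does not vanish on the
    whole plane of \<open>a\<close>.\<close>
  ultimately have "\<exists>v. dot a v = 0 \<and> (\<forall>b\<in>insert (axis j 1) F. dot b v \<noteq> 0)"
    using assms by (intro exists_avoiding) auto
  then obtain v where v: "dot a v = 0" "\<And>b. b \<in> F \<Longrightarrow> dot b v \<noteq> 0" "dot (axis j 1) v \<noteq> 0"
    by auto
  have "v \<noteq> 0" using v(3) by auto
  then obtain \<nu>0 where "dot v \<nu>0 = 1" using dual by blast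
  then have \<nu>0: "dot \<nu>0 v = 1" by (simp add: dot_def mult.commute)
  obtain w where w: "dot a w = 1" using dual[OF a] by auto
  \<comment> \<open>By the triple product expansion, \<open>cross u v\<close> is \<open>a\<close>,
    because \<nu>0 is 1 on \<open>v\<close> and \<open>a\<close> is 0 on \<open>v\<close>. The
    determinant of \<open>u, v, w\<close> is then 1, so the dual basis consists of cross
    products.\<close>
  define u where "u = cross \<nu>0 a"
  have cr: "cross u v = a"
  proof -
    have "cross u v = dot \<nu>0 v *s a - dot a v *s \<nu>0"
      by (simp add: Finite_Cartesian_Product.vec_eq_iff forall_3 u_def dot_def sum_3 algebra_simps)
    then show ?thesis by (simp add: \<nu>0 v)
  qed
  have det: "dot (cross u v) w = 1" using w by (simp add: cr)
  have "line_frame (cross u v) u v w (cross v w) (cross w u)"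
  proof
    show "vec_nth (cross v w) j * vec_nth u i + vec_nth (cross w u) j * vec_nth v i +
        vec_nth (cross u v) j * vec_nth w i = (if i = j then 1 else 0)" for i j :: 3
      using exhaust_3[of i] exhaust_3[of j] det
      by (elim disjE) (simp_all add: dot_def sum_3 algebra_simps)
  qed (use det in \<open>simp_all add: dot_def sum_3 algebra_simps\<close>)
  with v(2) show thesis using that cr by metis
qed

section \<open>Hilbert function of the polynomial ring and of sums of its twists\<close>

definition forms :: "int \<Rightarrow> S set" where
  "forms k = {p. homogeneous k p}"

lemma forms_subspace: "S_vs.subspace (forms k)"
  by (auto simp: S_vs.subspace_def forms_def intro: homogeneous_add homogeneous_const_mult)

definition hilb :: "int \<Rightarrow> int" where
  "hilb k = (if k < 0 then 0 else (k + 1) * (k + 2) div 2)"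

text \<open>The polynomial (k + 1) (k + 2) / 2 has the roots -1 and -2, so it still agrees with
  \<open>hilb\<close> there. The gap begins at -3, and this gap later bounds the largest
  exponent.\<close>

lemma hilb_double: "k \<ge> -2 \<Longrightarrow> 2 * hilb k = (k + 1) * (k + 2)"
proof -
  assume "k \<ge> -2"
  then have "k = -1 \<or> k = -2 \<or> k \<ge> 0" by auto
  moreover have "even ((k + 1) * (k + 2))" by simp
  ultimately show ?thesis by (auto simp: hilb_def)
qed

lemma linear_mult_S: "Vector_Spaces.linear (\<lambda>c p. const c * p) (\<lambda>c p. const c * p) (\<lambda>p. q * p)"
  by unfold_locales (simp_all add: algebra_simps)

text \<open>Restriction to a coordinate line maps the forms of degree n onto the polynomials of
  degree at most n, with kernel a copy of the forms of degree n - 1. The index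
  \<open>int n - 1\<close> lets the induction start with the zero space in degree -1.\<close>

lemma dim_forms_aux: "S_vs.fin_dim (forms (int n - 1)) \<and> int (S_vs.dim (forms (int n - 1))) = hilb (int n - 1)"
proof (induction n)
  case 0
  have "forms (- 1) = {0}" using homogeneous_neg by (auto simp: forms_def)
  then show ?case by (simp add: hilb_def)
next
  case (Suc n)
  have "(axis 1 1 :: complex ^ 3) \<noteq> 0" by (simp add: axis_eq_0_iff)
  then obtain u v w \<mu> \<nu> where "line_frame (axis 1 1) u v w \<mu> \<nu>"
    by (rule exists_line_frame[where F = "{}"]) auto
  then interpret line_frame "axis 1 1" u v w \<mu> \<nu> .
  let ?l = "linear_form (axis 1 1)"
  have ker: "{p \<in> forms (int n). line_res u v p = 0} = (\<lambda>p. ?l * p) ` forms (int n - 1)"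
    using line_res_eq_0_iff[of "int n"] homogeneous_mult[OF homogeneous_linear_form, of "int n - 1"]
    by (fastforce simp: forms_def line_res_mult a_u a_v)
  have im: "line_res u v ` forms (int n) = poly_below (n + 1)"
    using line_res_image[of "int n"] by (simp add: forms_def nat_add_distrib)
  have "?l \<noteq> 0"
  proof
    assume "?l = 0"
    then have "line_res (axis 1 1) 0 ?l = 0" by simp
    then show False by (simp add: axis_nth)
  qed
  then have inj: "p = 0" if "?l * p = 0" for p using that by simp
  have k: "S_vs.fin_dim ((\<lambda>p. ?l * p) ` forms (int n - 1))"
    "S_vs.dim ((\<lambda>p. ?l * p) ` forms (int n - 1)) = S_vs.dim (forms (int n - 1))"
    using S_S.rank_nullity(1)[OF linear_mult_S] S_S.dim_image_inj[OF linear_mult_S inj] Suc by auto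
  have fin: "S_vs.fin_dim (forms (int n))"
    using S_poly.fin_dim_kernel_image[OF linear_line_res[of u v] forms_subspace, of "int n"]
      k(1) dim_poly_below
    by (simp add: ker im)
  have "S_vs.dim (forms (int n)) = S_vs.dim (forms (int n - 1)) + (n + 1)"
    using S_poly.rank_nullity(2)[OF linear_line_res[of u v] fin] k(2) dim_poly_below
    by (simp add: ker im)
  then have "int (S_vs.dim (forms (int n))) = hilb (int n)"
    using Suc hilb_double[of "int n"] hilb_double[of "int n - 1"] by (simp add: algebra_simps)
  then show ?case using fin by simp
qed

lemma fin_dim_forms: "S_vs.fin_dim (forms k)"
  and dim_forms: "int (S_vs.dim (forms k)) = hilb k"
proof -
  have "S_vs.fin_dim (forms k) \<and> int (S_vs.dim (forms k)) = hilb k"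
  proof (cases "k < -1")
    case True
    then have "forms k = {0}" using homogeneous_neg by (auto simp: forms_def)
    then show ?thesis using True by (simp add: hilb_def)
  next
    case False
    then have "int (nat (k + 1)) - 1 = k" by simp
    then show ?thesis using dim_forms_aux[of "nat (k + 1)"] by metis
  qed
  then show "S_vs.fin_dim (forms k)" "int (S_vs.dim (forms k)) = hilb k" by auto
qed

text \<open>The degree may depend on the component: \<open>forms3 (\<lambda>i. k - D i)\<close> is
  the piece of degree k of the direct sum of the modules S(-D i).\<close>

definition forms3 :: "(3 \<Rightarrow> int) \<Rightarrow> (S ^ 3) set" where
  "forms3 n = {v. \<forall>i. homogeneous (n i) (vec_nth v i)}"

lemma linear_vec_nth: "Vector_Spaces.linear (\<lambda>c v. const c *s v) (\<lambda>c p. const c * p) (\<lambda>v. vec_nth v i)"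
  by unfold_locales simp_all

lemma dim_product:
  fixes A :: "3 \<Rightarrow> S set"
  assumes fin: "\<And>i. S_vs.fin_dim (A i)" and "finite I"
  defines "V \<equiv> \<lambda>I. {v :: S ^ 3. \<forall>i. if i \<in> I then vec_nth v i \<in> A i else vec_nth v i = 0}"
  shows "S3_vs.fin_dim (V I) \<and> S3_vs.dim (V I) = (\<Sum>i\<in>I. S_vs.dim (A i))"
  using \<open>finite I\<close>
proof (induction I rule: finite_induct)
  case empty
  have "V {} = {0}" by (auto simp: V_def Finite_Cartesian_Product.vec_eq_iff)
  then show ?case by simp
next
  case (insert j I)
  have sub: "S_vs.subspace (A i)" for i using fin by (simp add: S_vs.fin_dim_def)
  have A: "0 \<in> A i" "x \<in> A i \<Longrightarrow> y \<in> A i \<Longrightarrow> x + y \<in> A i" "x \<in> A i \<Longrightarrow> const c * x \<in> A i" for i x y c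
    using sub[of i] by (auto simp: S_vs.subspace_def)
  have subV: "S3_vs.subspace (V (insert j I))"
    by (auto simp: S3_vs.subspace_def V_def A)
  have ker: "{v \<in> V (insert j I). vec_nth v j = 0} = V I"
    using insert.hyps(2) A(1) unfolding V_def by (fastforce split: if_splits)
  have im: "(\<lambda>v. vec_nth v j) ` V (insert j I) = A j"
  proof (intro subset_antisym subsetI)
    fix p assume p: "p \<in> A j"
    show "p \<in> (\<lambda>v. vec_nth v j) ` V (insert j I)"
      using p A(1) by (intro image_eqI[of _ _ "axis j p"]) (auto simp: V_def axis_def)
  qed (auto simp: V_def split: if_splits)
  have fd: "S3_vs.fin_dim (V (insert j I))"
    using S3_S.fin_dim_kernel_image[OF linear_vec_nth subV, of j] insert.IH fin[of j]
    by (simp add: ker im)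
  then show ?case
    using S3_S.rank_nullity(2)[OF linear_vec_nth fd, of j] insert
    by (simp add: ker im)
qed

lemma fin_dim_forms3: "S3_vs.fin_dim (forms3 n)"
  and dim_forms3: "int (S3_vs.dim (forms3 n)) = (\<Sum>i\<in>UNIV. hilb (n i))"
proof -
  have "forms3 n = {v. \<forall>i. if i \<in> UNIV then vec_nth v i \<in> forms (n i) else vec_nth v i = 0}"
    by (simp add: forms3_def forms_def)
  then show "S3_vs.fin_dim (forms3 n)" "int (S3_vs.dim (forms3 n)) = (\<Sum>i\<in>UNIV. hilb (n i))"
    using dim_product[of "\<lambda>i. forms (n i)" UNIV, OF fin_dim_forms] by (simp_all add: dim_forms)
qed

section \<open>Logarithmic derivations\<close>

text \<open>For nonzero forms this says that they are not proportional. The witness is a point of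
  the first line off the second, which is what the choice of a frame requires.\<close>

definition line_indep :: "complex ^ 3 \<Rightarrow> complex ^ 3 \<Rightarrow> bool" where
  "line_indep a b \<longleftrightarrow> (\<exists>x. dot a x = 0 \<and> dot b x \<noteq> 0)"

definition arrangement_forms :: "(complex ^ 3) set \<Rightarrow> bool" where
  "arrangement_forms F \<longleftrightarrow> finite F \<and> (\<forall>a\<in>F. a \<noteq> 0) \<and> (\<forall>a\<in>F. \<forall>b\<in>F. a \<noteq> b \<longrightarrow> line_indep a b)"

lemma arrangement_forms_subset: "arrangement_forms F \<Longrightarrow> G \<subseteq> F \<Longrightarrow> arrangement_forms G"
  unfolding arrangement_forms_def by (blast intro: finite_subset)

text \<open>
  For the product \<open>f\<close> of the forms in \<open>F\<close>, the condition \<open>\<theta>(f) \<in> (f)\<close> is equivalent to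
  \<open>b\<close> dividing \<open>\<theta>(b)\<close> for every \<open>b \<in> F\<close>.
\<close>

definition deriv_module :: "(complex ^ 3) set \<Rightarrow> int \<Rightarrow> (S ^ 3) set" where
  "deriv_module F k = {\<theta> \<in> forms3 (\<lambda>_. k). \<forall>b\<in>F. linear_form b dvd dot (cvec b) \<theta>}"

lemma homogeneous_dot:
  assumes "\<theta> \<in> forms3 (\<lambda>_. k)"
  shows "homogeneous k (dot (cvec a) \<theta>)"
  using assms unfolding dot_def forms3_def
  by (intro homogeneous_sum) (auto intro: homogeneous_const_mult)

lemma deriv_module_subspace: "S3_vs.subspace (deriv_module F k)"
  unfolding S3_vs.subspace_def
proof (intro conjI ballI allI)
  fix x y c assume xy: "x \<in> deriv_module F k"
  show "const c *s x \<in> deriv_module F k"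
    using xy by (auto simp: deriv_module_def forms3_def dot_scale_right intro: homogeneous_const_mult)
  assume "y \<in> deriv_module F k"
  with xy show "x + y \<in> deriv_module F k"
    by (auto simp: deriv_module_def forms3_def dot_add_right intro: homogeneous_add)
qed (auto simp: deriv_module_def forms3_def)

lemma fin_dim_deriv_module: "S3_vs.fin_dim (deriv_module F k)"
  by (rule S3_vs.fin_dim_subset[OF fin_dim_forms3 deriv_module_subspace])
    (auto simp: deriv_module_def)

text \<open>On the line \<open>c = 0\<close> the product of the other forms does not vanish
  identically, so the quotient found so far restricts to 0 and is divisible by \<open>c\<close>.
  This replaces unique factorization and keeps track of the degree.\<close>

lemma linear_form_prod_dvd:
  assumes "arrangement_forms F" "homogeneous k p" "\<And>b. b \<in> F \<Longrightarrow> linear_form b dvd p"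
  shows "\<exists>q. homogeneous (k - int (card F)) q \<and> p = (\<Prod>b\<in>F. linear_form b) * q"
proof -
  have "finite F" using assms(1) by (simp add: arrangement_forms_def)
  then show ?thesis using assms
  proof (induction F rule: finite_induct)
    case (insert c F)
    obtain q where q: "homogeneous (k - int (card F)) q" "p = (\<Prod>b\<in>F. linear_form b) * q"
      using insert arrangement_forms_subset[OF insert.prems(1), of F] by auto
    have c: "c \<noteq> 0" "\<exists>x. dot c x = 0 \<and> dot b x \<noteq> 0" if "b \<in> F" for b
      using insert.hyps insert.prems(1) that by (auto simp: arrangement_forms_def line_indep_def)
    have "c \<noteq> 0" using insert.prems(1) by (auto simp: arrangement_forms_def)
    then obtain u v w \<mu> \<nu> where fr: "line_frame c u v w \<mu> \<nu>" and v: "\<And>b. b \<in> F \<Longrightarrow> dot b v \<noteq> 0"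
      using exists_line_frame[OF _ insert.hyps(1) c(2)] by metis
    interpret line_frame c u v w \<mu> \<nu> by fact
    have "line_res u v p = 0"
      using insert.prems(3)[of c] by (auto simp: dvd_def line_res_mult a_u a_v)
    moreover have "line_res u v (\<Prod>b\<in>F. linear_form b) \<noteq> 0"
      using v insert.hyps(1) by (simp add: line_res_prod)
    ultimately have "line_res u v q = 0" by (simp add: q(2) line_res_mult)
    then obtain r where "homogeneous (k - int (card F) - 1) r" "q = linear_form c * r"
      using line_res_eq_0_iff[OF q(1)] by auto
    then show ?case using q insert.hyps by (intro exI[of _ r]) (auto simp: algebra_simps)
  qed simp
qed

section \<open>Polynomials in one variable: multiplicities and interpolation\<close>

definition lin :: "complex \<Rightarrow> complex poly" where "lin \<tau> = [:- \<tau>, 1:]"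

lemma lin_nonzero [simp]: "lin \<tau> \<noteq> 0" by (simp add: lin_def)

text \<open>The factors at the other nodes do not vanish at \<sigma>, so dividing them out leaves
  the order at \<sigma> unchanged.\<close>

lemma prod_lin_power_dvd:
  assumes "finite R" "\<And>\<tau>. \<tau> \<in> R \<Longrightarrow> lin \<tau> ^ e \<tau> dvd p"
  shows "(\<Prod>\<tau>\<in>R. lin \<tau> ^ e \<tau>) dvd p"
  using assms
proof (induction R rule: finite_induct)
  case (insert \<sigma> R)
  then obtain q where q: "p = (\<Prod>\<tau>\<in>R. lin \<tau> ^ e \<tau>) * q" by (auto elim: dvdE)
  show ?case
  proof (cases "q = 0")
    case False
    let ?P = "\<Prod>\<tau>\<in>R. lin \<tau> ^ e \<tau>"
    have "poly ?P \<sigma> \<noteq> 0" using insert.hyps by (auto simp: poly_prod lin_def)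
    moreover have "?P \<noteq> 0" using insert.hyps by simp
    ultimately have "Polynomial.order \<sigma> p = Polynomial.order \<sigma> q"
      using False unfolding q by (subst order_mult) (auto simp: order_root)
    moreover have "p \<noteq> 0" using False insert.hyps by (simp add: q)
    moreover have "[:- \<sigma>, 1:] ^ e \<sigma> dvd p"
      using insert.prems[of \<sigma>] by (simp add: lin_def)
    ultimately have "[:- \<sigma>, 1:] ^ e \<sigma> dvd q"
      using False by (simp add: order_divides)
    then show ?thesis using insert.hyps by (auto simp: q lin_def mult.commute)
  qed (simp add: q)
qed simp

lemma poly_below_dvd:
  assumes "p * q \<in> poly_below n" "p \<noteq> 0"
  shows "q \<in> poly_below (n - Polynomial.degree p)"
  using assms by (cases "q = 0") (auto simp: poly_below_iff degree_mult_eq)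

lemma degree_prod_lin_power:
  "finite R \<Longrightarrow> Polynomial.degree (\<Prod>\<tau>\<in>R. lin \<tau> ^ e \<tau>) = (\<Sum>\<tau>\<in>R. e \<tau>)"
  by (subst degree_prod_eq_sum_degree) (auto simp: degree_power_eq lin_def)

text \<open>Lagrange interpolation with polynomial coefficients. A multiple of the product over the
  old nodes is subtracted so that the rest vanishes at the new node \<sigma>; the quotient by
  \<open>lin \<sigma>\<close> is decomposed by induction.\<close>

lemma lagrange_decomp:
  assumes "finite T" "T \<noteq> {}" "g \<in> poly_below (card T + j)"
  shows "\<exists>r. (\<forall>\<tau>\<in>T. r \<tau> \<in> poly_below (Suc j)) \<and> g = (\<Sum>\<tau>\<in>T. r \<tau> * (\<Prod>\<sigma>\<in>T - {\<tau>}. lin \<sigma>))"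
  using assms
proof (induction T arbitrary: g rule: finite_ne_induct)
  case (singleton \<tau>)
  then show ?case by (intro exI[of _ "\<lambda>_. g"]) auto
next
  case (insert \<sigma> T)
  let ?P = "\<Prod>\<tau>\<in>T. lin \<tau>"
  have P\<sigma>: "poly ?P \<sigma> \<noteq> 0" using insert.hyps by (auto simp: poly_prod lin_def)
  define c where "c = poly g \<sigma> / poly ?P \<sigma>"
  have "poly (g - Polynomial.smult c ?P) \<sigma> = 0" using P\<sigma> by (simp add: c_def)
  then obtain h where h: "g - Polynomial.smult c ?P = lin \<sigma> * h"
    unfolding poly_eq_0_iff_dvd lin_def[of \<sigma>] by (auto simp only: dvd_def)
  have "Polynomial.degree ?P = card T"
    using degree_prod_lin_power[OF insert.hyps(1), of "\<lambda>_. 1"] by simp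
  then have "?P \<in> poly_below (card (insert \<sigma> T) + j)"
    using insert.hyps by (auto simp: poly_below_iff)
  then have "g - Polynomial.smult c ?P \<in> poly_below (card (insert \<sigma> T) + j)"
    using insert.prems by (auto simp: poly_below_def)
  then have "h \<in> poly_below (card T + j)"
    using poly_below_dvd[of "lin \<sigma>" h "card (insert \<sigma> T) + j"] insert.hyps h by (simp add: lin_def)
  then obtain r where r: "\<And>\<tau>. \<tau> \<in> T \<Longrightarrow> r \<tau> \<in> poly_below (Suc j)"
    "h = (\<Sum>\<tau>\<in>T. r \<tau> * (\<Prod>\<sigma>\<in>T - {\<tau>}. lin \<sigma>))"
    using insert.IH by blast
  have "lin \<sigma> * h = (\<Sum>\<tau>\<in>T. r \<tau> * (\<Prod>\<rho>\<in>insert \<sigma> T - {\<tau>}. lin \<rho>))"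
    unfolding r(2) sum_distrib_left
  proof (intro sum.cong refl)
    fix \<tau> assume \<tau>: "\<tau> \<in> T"
    then have "insert \<sigma> T - {\<tau>} = insert \<sigma> (T - {\<tau>})" using insert.hyps by auto
    then show "lin \<sigma> * (r \<tau> * (\<Prod>\<sigma>\<in>T - {\<tau>}. lin \<sigma>)) = r \<tau> * (\<Prod>\<rho>\<in>insert \<sigma> T - {\<tau>}. lin \<rho>)"
      using insert.hyps by (simp add: algebra_simps)
  qed
  then have g: "g = [:c:] * ?P + (\<Sum>\<tau>\<in>T. r \<tau> * (\<Prod>\<rho>\<in>insert \<sigma> T - {\<tau>}. lin \<rho>))"
    using h by (simp add: algebra_simps)
  have "g = (\<Sum>\<tau>\<in>insert \<sigma> T. (if \<tau> = \<sigma> then [:c:] else r \<tau>) * (\<Prod>\<rho>\<in>insert \<sigma> T - {\<tau>}. lin \<rho>))"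
  proof -
    have "(\<Sum>\<tau>\<in>T. (if \<tau> = \<sigma> then [:c:] else r \<tau>) * (\<Prod>\<rho>\<in>insert \<sigma> T - {\<tau>}. lin \<rho>)) =
       (\<Sum>\<tau>\<in>T. r \<tau> * (\<Prod>\<rho>\<in>insert \<sigma> T - {\<tau>}. lin \<rho>))"
      using insert.hyps by (intro sum.cong) auto
    moreover have "insert \<sigma> T - {\<sigma>} = T" using insert.hyps by auto
    ultimately show ?thesis using g insert.hyps by simp
  qed
  then show ?case using r(1)
    by (intro exI[of _ "\<lambda>\<tau>. if \<tau> = \<sigma> then [:c:] else r \<tau>"])
      (auto simp: poly_below_def coeff_pCons split: nat.splits)
qed

section \<open>Gradients of products of linear forms\<close>

text \<open>By the product rule, this is the gradient of the product of the forms in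
  \<open>J\<close>. The explicit sum makes reduction modulo a single form of \<open>J\<close>
  immediate.\<close>

definition grad :: "(complex ^ 3) set \<Rightarrow> S ^ 3" where
  "grad J = (\<Sum>b\<in>J. (\<Prod>c\<in>J - {b}. linear_form c) *s cvec b)"

lemma grad_nth: "vec_nth (grad J) i = (\<Sum>b\<in>J. (\<Prod>c\<in>J - {b}. linear_form c) * const (vec_nth b i))"
  by (simp add: grad_def)

lemma homogeneous_grad:
  assumes "finite J" "J \<noteq> {}"
  shows "homogeneous (int (card J) - 1) (vec_nth (grad J) i)"
  unfolding grad_nth
proof (intro homogeneous_sum)
  fix b assume b: "b \<in> J"
  have "homogeneous (int (card (J - {b}))) (\<Prod>c\<in>J - {b}. linear_form c)"
    by (intro homogeneous_prod) simp
  moreover have "int (card (J - {b})) = int (card J) - 1"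
    using assms b by (simp add: card_Diff_singleton of_nat_diff card_gt_0_iff Suc_le_eq)
  ultimately show "homogeneous (int (card J) - 1) ((\<Prod>c\<in>J - {b}. linear_form c) * const (vec_nth b i))"
    by (simp add: homogeneous_const_mult mult.commute)
qed

lemma grad_mod:
  assumes "finite J" "b \<in> J"
  shows "\<exists>r. grad J = (\<Prod>c\<in>J - {b}. linear_form c) *s cvec b + linear_form b *s r"
proof -
  define r where "r = (\<Sum>e\<in>J - {b}. (\<Prod>c\<in>J - {e} - {b}. linear_form c) *s cvec e)"
  have "(\<Prod>c\<in>J - {e}. linear_form c) *s cvec e =
      linear_form b *s ((\<Prod>c\<in>J - {e} - {b}. linear_form c) *s cvec e)" if "e \<in> J - {b}" for e
  proof -
    have "(\<Prod>c\<in>J - {e}. linear_form c) = linear_form b * (\<Prod>c\<in>J - {e} - {b}. linear_form c)"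
      using assms that by (intro prod.remove) auto
    then show ?thesis by (simp only: vector_smult_assoc)
  qed
  then have "(\<Sum>e\<in>J - {b}. (\<Prod>c\<in>J - {e}. linear_form c) *s cvec e) = linear_form b *s r"
    unfolding r_def S_cubed.scale_sum_right by (intro sum.cong) auto
  then show ?thesis
    unfolding grad_def using assms by (subst sum.remove[of J b]) auto
qed

text \<open>Modulo \<open>b\<close>, the gradient is a multiple of the coefficient vector of
  \<open>b\<close>, and a determinant with two proportional rows vanishes.\<close>

lemma dot_cross_left_grad_dvd:
  assumes "finite J" "b \<in> J"
  shows "linear_form b dvd dot (cvec b) (cross (grad J) y)"
    and "linear_form b dvd dot (cvec b) (cross y (grad J))"
proof -
  obtain r where r: "grad J = (\<Prod>c\<in>J - {b}. linear_form c) *s cvec b + linear_form b *s r"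
    using grad_mod[OF assms] by blast
  have "dot (cvec b) (cross (grad J) y) = linear_form b * dot (cvec b) (cross r y)"
    unfolding r by (simp add: dot_def sum_3 algebra_simps)
  then show "linear_form b dvd dot (cvec b) (cross (grad J) y)" by simp
  have "dot (cvec b) (cross y (grad J)) = linear_form b * dot (cvec b) (cross y r)"
    unfolding r by (simp add: dot_def sum_3 algebra_simps)
  then show "linear_form b dvd dot (cvec b) (cross y (grad J))" by simp
qed

text \<open>
  Adding the line \<open>a = 0\<close> to the arrangement \<open>F\<close>. The point \<open>v\<close> at infinity of
  the line lies on no line of \<open>F\<close>, so the intersection points of \<open>a = 0\<close> with the lines
  of \<open>F\<close> are the points \<open>u + \<tau> v\<close>.
\<close>

locale adding_line = line_frame +
  fixes F :: "(complex ^ 3) set"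
  assumes arr: "arrangement_forms F" and v_off: "\<And>b. b \<in> F \<Longrightarrow> dot b v \<noteq> 0"
begin

definition point :: "complex ^ 3 \<Rightarrow> complex" where "point b = - dot b u / dot b v"

definition through :: "complex \<Rightarrow> (complex ^ 3) set" where "through \<tau> = {b \<in> F. point b = \<tau>}"

definition points :: "complex set" where "points = point ` F"

text \<open>The common factor of all \<theta>(a) on the new line. Its degree is the number of lines
  minus the number of intersection points, which is the shift in the exact sequence.\<close>

definition mult_poly :: "complex poly" where
  "mult_poly = (\<Prod>\<tau>\<in>points. lin \<tau> ^ (card (through \<tau>) - 1))"

lemma finite_F: "finite F" using arr by (simp add: arrangement_forms_def)

lemma finite_through [simp]: "finite (through \<tau>)" by (simp add: through_def finite_F)

lemma finite_points [simp]: "finite points" by (simp add: points_def finite_F)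

lemma through_nonempty: "\<tau> \<in> points \<Longrightarrow> through \<tau> \<noteq> {}"
  by (auto simp: points_def through_def)

lemma card_through_pos: "\<tau> \<in> points \<Longrightarrow> card (through \<tau>) \<ge> 1"
  using through_nonempty by (simp add: card_gt_0_iff Suc_le_eq)

lemma sum_card_through: "(\<Sum>\<tau>\<in>points. card (through \<tau>)) = card F"
  using sum.group[OF finite_F finite_points, of point "\<lambda>_. 1 :: nat"]
  by (simp add: points_def through_def)

lemma degree_mult_poly: "Polynomial.degree mult_poly + card points = card F"
proof -
  have "Polynomial.degree mult_poly + card points = (\<Sum>\<tau>\<in>points. card (through \<tau>) - 1 + 1)"
    unfolding mult_poly_def by (subst degree_prod_lin_power) (simp_all add: sum_Suc)
  also have "\<dots> = (\<Sum>\<tau>\<in>points. card (through \<tau>))"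
    using card_through_pos by (intro sum.cong refl) (metis le_add_diff_inverse2)
  finally show ?thesis by (simp add: sum_card_through)
qed

lemma mult_poly_nonzero [simp]: "mult_poly \<noteq> 0"
  by (simp add: mult_poly_def)

lemma dot_u: "dot b v \<noteq> 0 \<Longrightarrow> dot b u = - point b * dot b v"
  by (simp add: point_def)

lemma line_res_lin: "dot b v \<noteq> 0 \<Longrightarrow> line_res u v (linear_form b) = Polynomial.smult (dot b v) (lin (point b))"
  using dot_u[of b] by (simp add: lin_def)

lemma vec_decomp: "b = dot b u *s \<mu> + dot b v *s \<nu> + dot b w *s a"
proof -
  have "vec_nth b j = vec_nth (dot b u *s \<mu> + dot b v *s \<nu> + dot b w *s a) j" for j
  proof -
    have "vec_nth b j = (\<Sum>i\<in>UNIV. (if i = j then 1 else 0) * vec_nth b i)"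
      by (simp add: if_distrib[of "\<lambda>c. c * _"] cong: if_cong)
    also have "\<dots> = vec_nth (dot b u *s \<mu> + dot b v *s \<nu> + dot b w *s a) j"
      by (simp add: unit[symmetric] dot_def sum_distrib_left sum_distrib_right sum.distrib algebra_simps)
    finally show ?thesis .
  qed
  then show ?thesis unfolding Finite_Cartesian_Product.vec_eq_iff by blast
qed

text \<open>
  If \<open>\<beta>\<close> is a line through the point \<open>\<tau>\<close>, then \<open>a \<theta>(\<beta>) - \<beta> \<theta>(a)\<close> is divisible by all lines through it,
  and it restricts to \<open>- \<beta> \<theta>(a)\<close> on the line \<open>a = 0\<close>.
\<close>

lemma image_dvd:
  assumes \<theta>: "\<theta> \<in> deriv_module F k"
  shows "mult_poly dvd line_res u v (dot (cvec a) \<theta>)"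
  unfolding mult_poly_def
proof (rule prod_lin_power_dvd)
  fix \<tau> assume \<tau>: "\<tau> \<in> points"
  have h: "homogeneous k (dot (cvec b) \<theta>)" for b
    using \<theta> by (simp add: deriv_module_def homogeneous_dot)
  obtain \<beta> where \<beta>: "\<beta> \<in> through \<tau>" using through_nonempty[OF \<tau>] by auto
  define p where "p = linear_form a * dot (cvec \<beta>) \<theta> - linear_form \<beta> * dot (cvec a) \<theta>"
  have hp: "homogeneous (1 + k) p"
    unfolding p_def by (intro homogeneous_diff homogeneous_mult h homogeneous_linear_form)
  have dvd: "linear_form c dvd p" if c: "c \<in> through \<tau>" for c
  proof -
    \<comment> \<open>Both lines pass through the point \<tau>, so
      \<open>c - \<kappa> \<beta>\<close> vanishes on \<open>u\<close> and \<open>v\<close>, that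
      is, on the whole line \<open>a = 0\<close>, and is a multiple of \<open>a\<close>.\<close>
    define \<kappa> where "\<kappa> = dot c v / dot \<beta> v"
    have cv: "c \<in> F" "\<beta> \<in> F" "dot c v \<noteq> 0" "dot \<beta> v \<noteq> 0" "point c = point \<beta>"
      using c \<beta> v_off by (auto simp: through_def)
    have "dot c u = \<kappa> * dot \<beta> u" "dot c v = \<kappa> * dot \<beta> v"
      using cv by (simp_all add: \<kappa>_def dot_u)
    then have "c = \<kappa> *s \<beta> + (dot c w - \<kappa> * dot \<beta> w) *s a"
      by (subst (1) vec_decomp, subst (4) vec_decomp)
        (simp add: Finite_Cartesian_Product.vec_eq_iff algebra_simps)
    then obtain \<epsilon> where eq: "c = \<kappa> *s \<beta> + \<epsilon> *s a" by blast
    \<comment> \<open>The expression is alternating in the pair \<open>a, c\<close>, so the summand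
      \<epsilon> a of \<open>c\<close> contributes nothing.\<close>
    have "linear_form a * dot (cvec c) \<theta> - linear_form c * dot (cvec a) \<theta> = const \<kappa> * p"
      unfolding eq p_def by (simp add: linear_form_dot dot_def sum_3 algebra_simps)
    moreover have "linear_form c dvd dot (cvec c) \<theta>"
      using \<theta> cv by (auto simp: deriv_module_def)
    ultimately have "linear_form c dvd const \<kappa> * p"
      by (metis dvd_diff dvd_mult dvd_triv_left)
    then have "linear_form c dvd const (1 / \<kappa>) * (const \<kappa> * p)" by (rule dvd_mult)
    moreover have "const (1 / \<kappa>) * (const \<kappa> * p) = const (1 / \<kappa> * \<kappa>) * p"
      by (simp only: const_hom mult.assoc)
    moreover have "1 / \<kappa> * \<kappa> = 1" using cv by (simp add: \<kappa>_def)
    ultimately show ?thesis by (simp only: const_hom mult_1_left)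
  qed
  have "arrangement_forms (through \<tau>)"
    using arrangement_forms_subset[OF arr] by (auto simp: through_def)
  from linear_form_prod_dvd[OF this hp dvd] obtain q
    where q: "p = (\<Prod>b\<in>through \<tau>. linear_form b) * q" by blast
  have lin_b: "line_res u v (linear_form b) = Polynomial.smult (dot b v) (lin \<tau>)"
    if "b \<in> through \<tau>" for b
    using that v_off by (subst line_res_lin) (auto simp: through_def)
  have "line_res u v p = - (Polynomial.smult (dot \<beta> v) (lin \<tau>)) * line_res u v (dot (cvec a) \<theta>)"
    unfolding p_def line_res_diff line_res_mult lin_b[OF \<beta>] by (simp add: a_u a_v)
  moreover have "line_res u v p = Polynomial.smult (\<Prod>b\<in>through \<tau>. dot b v) (lin \<tau> ^ card (through \<tau>)) * line_res u v q"
    unfolding q line_res_mult line_res_prod by (simp add: lin_b prod_smult del: line_res_linear_form)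
  moreover have "dot \<beta> v \<noteq> 0" using \<beta> v_off by (auto simp: through_def)
  moreover have "lin \<tau> ^ card (through \<tau>) = lin \<tau> * lin \<tau> ^ (card (through \<tau>) - 1)"
    using card_through_pos[OF \<tau>] by (simp flip: power_Suc)
  \<comment> \<open>The factor \<open>lin \<tau>\<close> on the left is the restriction of \<beta>;
    cancelling it turns the exponent m into m - 1 for a point on m lines.\<close>
  ultimately have "lin \<tau> * Polynomial.smult (- dot \<beta> v) (line_res u v (dot (cvec a) \<theta>)) =
      lin \<tau> * (lin \<tau> ^ (card (through \<tau>) - 1) * Polynomial.smult (\<Prod>b\<in>through \<tau>. dot b v) (line_res u v q))"
    by (simp add: algebra_simps)
  then have "Polynomial.smult (- dot \<beta> v) (line_res u v (dot (cvec a) \<theta>)) =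
      lin \<tau> ^ (card (through \<tau>) - 1) * Polynomial.smult (\<Prod>b\<in>through \<tau>. dot b v) (line_res u v q)"
    by (simp only: mult_cancel_left lin_nonzero) simp
  then have "lin \<tau> ^ (card (through \<tau>) - 1) dvd Polynomial.smult (- dot \<beta> v) (line_res u v (dot (cvec a) \<theta>))"
    by (metis dvd_triv_left)
  then show "lin \<tau> ^ (card (through \<tau>) - 1) dvd line_res u v (dot (cvec a) \<theta>)"
    using \<open>dot \<beta> v \<noteq> 0\<close> by (simp add: dvd_smult_iff)
qed simp

text \<open>All forms of \<open>J\<close> restrict to multiples of \<open>lin \<tau>\<close>, so
  only their leading factors survive in the weights of \<open>e\<close>. Its value on
  \<open>v\<close> is \<open>card J\<close> times a nonzero product, hence nonzero in characteristic
  0.\<close>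

lemma line_res_grad:
  assumes J: "finite J" "J \<noteq> {}" and pt: "\<And>b. b \<in> J \<Longrightarrow> dot b v \<noteq> 0 \<and> point b = \<tau>"
  obtains e where "dot e v \<noteq> 0" "dot e u = - \<tau> * dot e v"
    "\<And>i. line_res u v (vec_nth (grad J) i) = Polynomial.smult (vec_nth e i) (lin \<tau> ^ (card J - 1))"
proof
  define e where "e = (\<Sum>b\<in>J. (\<Prod>c\<in>J - {b}. dot c v) *s b)"
  have lin_b: "line_res u v (linear_form b) = Polynomial.smult (dot b v) (lin \<tau>)" if "b \<in> J" for b
    using that pt by (subst line_res_lin) auto
  have "dot e v = (\<Sum>b\<in>J. \<Prod>c\<in>J. dot c v)"
    unfolding e_def dot_sum_left dot_scale_left
    using J by (intro sum.cong refl) (simp add: prod.remove mult.commute)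
  then show "dot e v \<noteq> 0" using J pt by simp
  show "dot e u = - \<tau> * dot e v"
    unfolding e_def dot_sum_left dot_scale_left sum_distrib_left
    using pt by (intro sum.cong refl) (auto simp: dot_u)
  fix i
  have "line_res u v (vec_nth (grad J) i) =
      (\<Sum>b\<in>J. (\<Prod>c\<in>J - {b}. Polynomial.smult (dot c v) (lin \<tau>)) * [:vec_nth b i:])"
    unfolding grad_nth by (simp add: line_res_sum line_res_mult line_res_prod lin_b del: line_res_linear_form)
  also have "\<dots> = (\<Sum>b\<in>J. Polynomial.smult ((\<Prod>c\<in>J - {b}. dot c v) * vec_nth b i) (lin \<tau> ^ (card J - 1)))"
    using J by (intro sum.cong refl) (simp add: prod_smult mult.commute)
  also have "\<dots> = Polynomial.smult (vec_nth e i) (lin \<tau> ^ (card J - 1))"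
    by (simp add: e_def smult_sum)
  finally show "line_res u v (vec_nth (grad J) i) = Polynomial.smult (vec_nth e i) (lin \<tau> ^ (card J - 1))" .
qed

text \<open>With \<open>a = cross u v\<close>, the Binet-Cauchy identity evaluates the constant as a
  nonzero multiple of \<tau> - \<sigma>; this is why two distinct points are needed.\<close>

lemma line_res_grad_cross:
  assumes J: "finite J" "J \<noteq> {}" "\<And>b. b \<in> J \<Longrightarrow> dot b v \<noteq> 0 \<and> point b = \<sigma>"
    and K: "finite K" "K \<noteq> {}" "\<And>b. b \<in> K \<Longrightarrow> dot b v \<noteq> 0 \<and> point b = \<tau>"
    and "\<sigma> \<noteq> \<tau>"
  shows "\<exists>c. c \<noteq> 0 \<and> line_res u v (dot (cvec a) (cross (grad J) (grad K))) =
    Polynomial.smult c (lin \<sigma> ^ (card J - 1) * lin \<tau> ^ (card K - 1))"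
proof -
  obtain e where e: "dot e v \<noteq> 0" "dot e u = - \<sigma> * dot e v"
    "\<And>i. line_res u v (vec_nth (grad J) i) = Polynomial.smult (vec_nth e i) (lin \<sigma> ^ (card J - 1))"
    using line_res_grad[OF J] by blast
  obtain e' where e': "dot e' v \<noteq> 0" "dot e' u = - \<tau> * dot e' v"
    "\<And>i. line_res u v (vec_nth (grad K) i) = Polynomial.smult (vec_nth e' i) (lin \<tau> ^ (card K - 1))"
    using line_res_grad[OF K] by blast
  have "line_res u v (dot (cvec a) (cross (grad J) (grad K))) =
    Polynomial.smult (dot a (cross e e')) (lin \<sigma> ^ (card J - 1) * lin \<tau> ^ (card K - 1))"
    by (simp add: dot_def sum_3 line_res_add line_res_mult line_res_diff e(3) e'(3)
        smult_add_left smult_diff_left smult_diff_right mult_ac algebra_simps)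
  moreover have "dot a (cross e e') = dot e u * dot e' v - dot e v * dot e' u"
    unfolding cross_uv[symmetric] by (simp add: dot_def sum_3 algebra_simps)
  then have "dot a (cross e e') = dot e v * dot e' v * (\<tau> - \<sigma>)"
    by (simp add: e(2) e'(2) algebra_simps)
  ultimately show ?thesis using e(1) e'(1) assms(7) by auto
qed

lemma prod_lin_point:
  assumes "Q \<subseteq> points"
  shows "(\<Prod>b\<in>{b \<in> F. point b \<in> Q}. lin (point b)) = (\<Prod>q\<in>Q. lin q ^ card (through q))"
proof -
  have Q: "finite Q" using assms finite_points by (rule finite_subset)
  have "(\<Prod>b\<in>{b \<in> F. point b \<in> Q}. lin (point b)) =
      (\<Prod>q\<in>Q. \<Prod>b\<in>{b \<in> {b \<in> F. point b \<in> Q}. point b = q}. lin (point b))"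
    by (intro prod.group[symmetric] Q) (auto simp: finite_F)
  also have "\<dots> = (\<Prod>q\<in>Q. lin q ^ card (through q))"
  proof (intro prod.cong refl)
    fix q assume "q \<in> Q"
    then have "{b \<in> {b \<in> F. point b \<in> Q}. point b = q} = through q" by (auto simp: through_def)
    moreover have "(\<Prod>b\<in>through q. lin (point b)) = (\<Prod>b\<in>through q. lin q)"
      by (intro prod.cong) (auto simp: through_def)
    ultimately show "(\<Prod>b\<in>{b \<in> {b \<in> F. point b \<in> Q}. point b = q}. lin (point b)) = lin q ^ card (through q)"
      by simp
  qed
  finally show ?thesis .
qed

text \<open>
  The cross product of the gradients of two products of linear forms kills both products, so it
  preserves all lines through the points \<open>\<sigma>\<close> and \<open>\<tau>\<close>.
\<close>

lemma two_point_derivation: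
  assumes \<sigma>: "\<sigma> \<in> points" and "\<sigma> \<noteq> \<tau>" and K: "finite K" "K \<noteq> {}"
    "\<And>b. b \<in> K \<Longrightarrow> dot b v \<noteq> 0 \<and> point b = \<tau>" and n: "n = int (card (F - through \<sigma> - K)) + int (card (through \<sigma>)) + int (card K) - 2"
  shows "\<exists>\<theta>\<in>deriv_module F n. \<exists>c. c \<noteq> 0 \<and> line_res u v (dot (cvec a) \<theta>) =
    Polynomial.smult c ((\<Prod>b\<in>F - through \<sigma> - K. lin (point b)) * lin \<sigma> ^ (card (through \<sigma>) - 1) * lin \<tau> ^ (card K - 1))"
proof -
  define J where "J = through \<sigma>"
  have J: "finite J" "J \<noteq> {}" "\<And>b. b \<in> J \<Longrightarrow> dot b v \<noteq> 0 \<and> point b = \<sigma>"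
    using through_nonempty[OF \<sigma>] v_off by (auto simp: J_def) (auto simp: through_def)
  \<comment> \<open>The forms of \<open>F\<close> outside \<open>J\<close> and \<open>K\<close>: the
    factor \<open>L\<close> makes \<theta> logarithmic along these lines too.\<close>
  define L where "L = (\<Prod>b\<in>F - J - K. linear_form b)"
  define \<theta> where "\<theta> = L *s cross (grad J) (grad K)"
  have homL: "homogeneous (int (card (F - J - K))) L"
    unfolding L_def by (rule homogeneous_prod) simp
  have homc: "homogeneous (int (card J) - 1 + (int (card K) - 1)) (vec_nth (cross (grad J) (grad K)) i)" for i
  proof -
    have hm: "homogeneous (int (card J) - 1 + (int (card K) - 1)) (vec_nth (grad J) i * vec_nth (grad K) j)" for i j
      by (intro homogeneous_mult homogeneous_grad J(1,2) K(1,2))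
    show ?thesis
      using exhaust_3[of i] by (elim disjE) (simp_all only: cross_nth homogeneous_diff hm)
  qed
  have "\<theta> \<in> forms3 (\<lambda>_. n)"
    unfolding forms3_def \<theta>_def using homL homc
    by (auto intro!: homogeneous_mult_eq simp: n J_def)
  moreover have "linear_form b dvd dot (cvec b) \<theta>" if b: "b \<in> F" for b
  proof (cases "b \<in> J \<or> b \<in> K")
    case True
    then show ?thesis unfolding \<theta>_def dot_scale_right
      using dot_cross_left_grad_dvd J(1) K(1) by (auto intro: dvd_mult)
  next
    case False
    then have "linear_form b dvd L"
      unfolding L_def using b finite_F by (intro dvd_prodI) auto
    then show ?thesis unfolding \<theta>_def dot_scale_right by simp
  qed
  ultimately have mem: "\<theta> \<in> deriv_module F n" by (simp add: deriv_module_def)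
  obtain c where c: "c \<noteq> 0" "line_res u v (dot (cvec a) (cross (grad J) (grad K))) =
      Polynomial.smult c (lin \<sigma> ^ (card J - 1) * lin \<tau> ^ (card K - 1))"
    using line_res_grad_cross[OF J K \<open>\<sigma> \<noteq> \<tau>\<close>] by blast
  have "line_res u v L = (\<Prod>b\<in>F - J - K. Polynomial.smult (dot b v) (lin (point b)))"
    unfolding L_def line_res_prod using v_off by (intro prod.cong refl line_res_lin) auto
  also have "\<dots> = Polynomial.smult (\<Prod>b\<in>F - J - K. dot b v) (\<Prod>b\<in>F - J - K. lin (point b))"
    by (simp add: prod_smult)
  finally have "line_res u v (dot (cvec a) \<theta>) = Polynomial.smult ((\<Prod>b\<in>F - J - K. dot b v) * c)
     ((\<Prod>b\<in>F - J - K. lin (point b)) * lin \<sigma> ^ (card J - 1) * lin \<tau> ^ (card K - 1))"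
    unfolding \<theta>_def dot_scale_right line_res_mult c(2) by (simp add: mult_ac)
  moreover have "(\<Prod>b\<in>F - J - K. dot b v) * c \<noteq> 0" using c(1) v_off finite_F by auto
  ultimately show ?thesis using mem unfolding J_def by blast
qed

text \<open>
  One point \<open>\<sigma>\<close> is kept fixed. If it is the only intersection point on the new line, an auxiliary line
  through another point \<open>\<sigma> + 1\<close> takes the place of the lines through the second point.
\<close>

lemma image_surj_aux:
  assumes \<sigma>: "\<sigma> \<in> points" and T: "T = (if card points = 1 then {\<sigma> + 1} else points - {\<sigma>})"
    and \<tau>: "\<tau> \<in> T" and n: "n = int (card F) - int (card points) + int (card T) - 1"
  shows "\<exists>\<theta>\<in>deriv_module F n. \<exists>c. c \<noteq> 0 \<and> line_res u v (dot (cvec a) \<theta>) =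
    Polynomial.smult c (mult_poly * (\<Prod>\<rho>\<in>T - {\<tau>}. lin \<rho>))"
proof (cases "card points = 1")
  case True
  then have pts: "points = {\<sigma>}" using \<sigma> by (metis card_1_singletonE singletonD)
  then have thr: "through \<sigma> = F" by (auto simp: through_def points_def)
  have T\<tau>: "T = {\<tau>}" "\<tau> = \<sigma> + 1" using T \<tau> True by auto
  \<comment> \<open>A form vanishing at \<open>u + \<tau> v\<close>. All lines of \<open>F\<close>
    meet the new one at \<sigma>, so with \<open>K = {\<gamma>}\<close> the product of the remaining
    lines is empty.\<close>
  define \<gamma> where "\<gamma> = \<nu> - \<tau> *s \<mu>"
  have "dot \<gamma> v = 1" "dot \<gamma> u = - \<tau>"
    by (simp_all add: \<gamma>_def dot_diff_left dot_scale_left \<mu>_u \<mu>_v \<nu>_u \<nu>_v)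
  then have \<gamma>: "dot \<gamma> v \<noteq> 0" "point \<gamma> = \<tau>" by (simp_all add: point_def)
  have "n = int (card (F - through \<sigma> - {\<gamma>})) + int (card (through \<sigma>)) + int (card {\<gamma>}) - 2"
    using True by (simp add: n T\<tau> thr)
  from two_point_derivation[OF \<sigma> _ _ _ _ this, of \<tau>] \<gamma> T\<tau>(2)
  show ?thesis by (simp add: thr T\<tau>(1) mult_poly_def pts)
next
  case False
  have \<tau>p: "\<tau> \<in> points" "\<tau> \<noteq> \<sigma>" using \<tau> T False by auto
  define Q where "Q = points - {\<sigma>, \<tau>}"
  have Q: "F - through \<sigma> - through \<tau> = {b \<in> F. point b \<in> Q}"
    by (auto simp: Q_def through_def points_def)
  have pts: "points = insert \<sigma> (insert \<tau> Q)" "\<sigma> \<notin> Q" "\<tau> \<notin> Q" "finite Q" "Q \<subseteq> points"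
    using \<sigma> \<tau>p by (auto simp: Q_def)
  have cardpts: "card points = card Q + 2" using pts \<tau>p(2) by simp
  have TQ: "T - {\<tau>} = Q" using T False by (auto simp: Q_def)
  have "T = insert \<tau> Q" using TQ \<tau> by auto
  then have cardT: "card T = card Q + 1" using pts by simp
  have disj: "through \<sigma> \<inter> through \<tau> = {}" using \<tau>p by (auto simp: through_def)
  have sub: "through \<sigma> \<subseteq> F" "through \<tau> \<subseteq> F - through \<sigma>" using disj by (auto simp: through_def)
  have "card F = card (F - through \<sigma>) + card (through \<sigma>)"
    using sub card_Diff_subset[OF _ sub(1)] card_mono[OF finite_F sub(1)] by simp
  moreover have "card (F - through \<sigma>) = card (F - through \<sigma> - through \<tau>) + card (through \<tau>)"
    using card_Diff_subset[OF _ sub(2)] card_mono[OF _ sub(2)] finite_F by simp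
  ultimately have n': "n = int (card (F - through \<sigma> - through \<tau>)) + int (card (through \<sigma>)) + int (card (through \<tau>)) - 2"
    using n cardpts cardT by simp
  \<comment> \<open>A point of \<open>Q\<close> contributes all its m lines, one factor more than in
    \<open>mult_poly\<close>; the surplus is the Lagrange product over
    \<open>T - {\<tau>}\<close>.\<close>
  have "(\<Prod>b\<in>F - through \<sigma> - through \<tau>. lin (point b)) = (\<Prod>q\<in>Q. lin q ^ card (through q))"
    unfolding Q by (rule prod_lin_point[OF pts(5)])
  also have "\<dots> = (\<Prod>q\<in>Q. lin q ^ (card (through q) - 1) * lin q)"
  proof (intro prod.cong refl)
    fix q assume "q \<in> Q"
    then have "card (through q) = Suc (card (through q) - 1)"
      using card_through_pos[of q] pts(5) by auto
    then show "lin q ^ card (through q) = lin q ^ (card (through q) - 1) * lin q"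
      by (metis power_Suc2)
  qed
  finally have "(\<Prod>b\<in>F - through \<sigma> - through \<tau>. lin (point b)) * lin \<sigma> ^ (card (through \<sigma>) - 1) *
      lin \<tau> ^ (card (through \<tau>) - 1) = mult_poly * (\<Prod>q\<in>Q. lin q)"
    using pts(2-4) \<tau>p(2) unfolding mult_poly_def pts(1)
    by (simp add: prod.distrib mult_ac)
  moreover have "dot b v \<noteq> 0 \<and> point b = \<tau>" if "b \<in> through \<tau>" for b
    using that v_off by (auto simp: through_def)
  ultimately show ?thesis
    using two_point_derivation[OF \<sigma> _ finite_through through_nonempty[OF \<tau>p(1)] _ n', of \<tau>] \<tau>p(2)
    by (auto simp: TQ)
qed

text \<open>The Lagrange products for the nodes \<open>T\<close> are attained in degree k - j. Their
  coefficients \<open>r \<tau>\<close>, lifted to forms of degree j, raise the derivations to degree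
  k, and the interpolation formula for \<open>g\<close> finishes.\<close>

lemma image_surj:
  assumes "F \<noteq> {}" and k: "k \<ge> int (card F) - 2" "k \<ge> 0"
    and g: "g \<in> poly_below (nat (k + 1 + int (card points) - int (card F)))"
  shows "\<exists>\<theta>\<in>deriv_module F k. line_res u v (dot (cvec a) \<theta>) = mult_poly * g"
proof -
  define N where "N = nat (k + 1 + int (card points) - int (card F))"
  obtain \<sigma> where \<sigma>: "\<sigma> \<in> points" using \<open>F \<noteq> {}\<close> by (auto simp: points_def)
  then have n1: "card points \<ge> 1" by (simp add: card_gt_0_iff Suc_le_eq) auto
  show ?thesis
  proof (cases "N = 0")
    case True
    then have "g = 0" using g by (simp add: N_def)
    then show ?thesis
      using S3_vs.subspace_0[OF deriv_module_subspace[of F k]] by (intro bexI[of _ 0]) auto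
  next
    case False
    define T where "T = (if card points = 1 then {\<sigma> + 1} else points - {\<sigma>})"
    have cardT: "card T = (if card points = 1 then 1 else card points - 1)"
      using \<sigma> by (simp add: T_def)
    then have "card T \<ge> 1" using n1 by auto
    then have T: "finite T" "T \<noteq> {}" by (auto intro: card_ge_0_finite)
    have N: "int N = k + 1 + int (card points) - int (card F)" using False by (simp add: N_def)
    \<comment> \<open>With several points, \<open>card T\<close> is one less than the number of
      points and the bound on k gives exactly this. With a single point the bound gives only N \<ge>
      0, and N = 0 has been excluded.\<close>
    then have "N \<ge> card T" using cardT k(1) False n1 by (auto split: if_splits)
    then obtain j where j: "N = card T + j" using le_Suc_ex by blast
    obtain r where r: "\<And>\<tau>. \<tau> \<in> T \<Longrightarrow> r \<tau> \<in> poly_below (Suc j)"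
      "g = (\<Sum>\<tau>\<in>T. r \<tau> * (\<Prod>\<rho>\<in>T - {\<tau>}. lin \<rho>))"
      using lagrange_decomp[OF T, of g j] g by (auto simp flip: N_def j)
    have "k - int j = int (card F) - int (card points) + int (card T) - 1" using N j by simp
    from image_surj_aux[OF \<sigma> T_def _ this]
    obtain \<theta> c where \<theta>: "\<And>\<tau>. \<tau> \<in> T \<Longrightarrow> \<theta> \<tau> \<in> deriv_module F (k - int j)"
        "\<And>\<tau>. \<tau> \<in> T \<Longrightarrow> c \<tau> \<noteq> 0"
        "\<And>\<tau>. \<tau> \<in> T \<Longrightarrow> line_res u v (dot (cvec a) (\<theta> \<tau>)) =
          Polynomial.smult (c \<tau>) (mult_poly * (\<Prod>\<rho>\<in>T - {\<tau>}. lin \<rho>))"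
      by metis
    have "\<exists>p. homogeneous (int j) p \<and> line_res u v p = Polynomial.smult (1 / c \<tau>) (r \<tau>)" if "\<tau> \<in> T" for \<tau>
      using homogeneous_lift_form line_res_lift_form[of "Polynomial.smult (1 / c \<tau>) (r \<tau>)" j] r(1)[OF that]
      by (metis poly_vs.subspace_scale[OF poly_below_subspace])
    then obtain p where p: "\<And>\<tau>. \<tau> \<in> T \<Longrightarrow> homogeneous (int j) (p \<tau>)"
      "\<And>\<tau>. \<tau> \<in> T \<Longrightarrow> line_res u v (p \<tau>) = Polynomial.smult (1 / c \<tau>) (r \<tau>)"
      by metis
    define \<Theta> where "\<Theta> = (\<Sum>\<tau>\<in>T. p \<tau> *s \<theta> \<tau>)"
    have "p \<tau> *s \<theta> \<tau> \<in> deriv_module F k" if "\<tau> \<in> T" for \<tau>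
      using \<theta>(1)[OF that] p(1)[OF that]
      by (auto simp: deriv_module_def forms3_def dot_scale_right intro: homogeneous_mult_eq)
    then have "\<Theta> \<in> deriv_module F k"
      unfolding \<Theta>_def by (rule S3_vs.subspace_sum[OF deriv_module_subspace])
    moreover have "line_res u v (dot (cvec a) \<Theta>) = mult_poly * g"
    proof -
      have "dot (cvec a) \<Theta> = (\<Sum>\<tau>\<in>T. p \<tau> * dot (cvec a) (\<theta> \<tau>))"
        unfolding \<Theta>_def by (induction T rule: infinite_finite_induct) (auto simp: dot_add_right dot_scale_right)
      then have "line_res u v (dot (cvec a) \<Theta>) = (\<Sum>\<tau>\<in>T. mult_poly * (r \<tau> * (\<Prod>\<rho>\<in>T - {\<tau>}. lin \<rho>)))"
        using p(2) \<theta>(2,3) by (simp add: line_res_sum line_res_mult mult_ac)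
      then show ?thesis by (simp add: r(2) sum_distrib_left)
    qed
    ultimately show ?thesis by blast
  qed
qed

lemma linear_act: "Vector_Spaces.linear (\<lambda>c v. const c *s v) Polynomial.smult (\<lambda>\<theta>. line_res u v (dot (cvec a) \<theta>))"
  by unfold_locales (simp_all add: dot_add_right dot_scale_right line_res_add line_res_mult)

lemma dim_insert_line:
  assumes k: "k \<ge> int (card F) - 2" "k \<ge> 0"
  shows "int (S3_vs.dim (deriv_module F k)) =
    int (S3_vs.dim (deriv_module (insert a F) k)) + (k + 1 + int (card points) - int (card F))"
proof -
  let ?f = "\<lambda>\<theta>. line_res u v (dot (cvec a) \<theta>)"
  define N where "N = nat (k + 1 + int (card points) - int (card F))"
  have N: "int N = k + 1 + int (card points) - int (card F)"
  proof (cases "F = {}")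
    case False
    then have "card points \<ge> 1" by (simp add: points_def card_gt_0_iff Suc_le_eq finite_F)
    then show ?thesis using k by (simp add: N_def)
  qed (use k in \<open>simp add: N_def points_def\<close>)
  have deg: "Polynomial.degree mult_poly + card points = card F" by (rule degree_mult_poly)
  have ker: "{\<theta> \<in> deriv_module F k. ?f \<theta> = 0} = deriv_module (insert a F) k"
    using dvd_iff_line_res[OF homogeneous_dot, of _ k a] by (auto simp: deriv_module_def)
  have im: "?f ` deriv_module F k = (\<lambda>g. mult_poly * g) ` poly_below N"
  proof (intro subset_antisym subsetI)
    fix h assume "h \<in> ?f ` deriv_module F k"
    then obtain \<theta> where \<theta>: "\<theta> \<in> deriv_module F k" "h = ?f \<theta>" by auto
    obtain g where g: "h = mult_poly * g" using image_dvd[OF \<theta>(1)] \<theta>(2) by (auto elim: dvdE)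
    have "\<theta> \<in> forms3 (\<lambda>_. k)" using \<theta>(1) by (simp add: deriv_module_def)
    then have "h \<in> poly_below (nat (k + 1))"
      unfolding \<theta>(2) by (intro line_res_below homogeneous_dot)
    then have "g \<in> poly_below (nat (k + 1) - Polynomial.degree mult_poly)"
      unfolding g by (rule poly_below_dvd) simp
    moreover have "nat (k + 1) - Polynomial.degree mult_poly = N"
      using N deg k(2) by linarith
    ultimately show "h \<in> (\<lambda>g. mult_poly * g) ` poly_below N" using g by blast
  next
    fix h assume "h \<in> (\<lambda>g. mult_poly * g) ` poly_below N"
    then obtain g where g: "g \<in> poly_below N" "h = mult_poly * g" by auto
    show "h \<in> ?f ` deriv_module F k"
    proof (cases "F = {}")
      case True
      have "points = point ` F" by (rule points_def)
      also have "\<dots> = {}" using True by simp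
      finally have pts: "points = {}" .
      with True have g': "g \<in> poly_below (Suc (nat k))" using g(1) k True by (simp add: N_def nat_add_distrib)
      define p where "p = lift_form (nat k) g"
      have p: "homogeneous k p" "line_res u v p = g"
        using homogeneous_lift_form[of "nat k" g] line_res_lift_form[OF g'] k by (simp_all add: p_def)
      \<comment> \<open>With no lines present every vector field is admissible, and the constant
        field \<open>w\<close> satisfies a(w) = 1.\<close>
      have "dot (cvec a) (p *s cvec w) = p"
      proof -
        have "dot (cvec a) (cvec w) = const (dot a w)" by (simp add: dot_def sum_3)
        then show ?thesis by (simp add: dot_scale_right a_w)
      qed
      moreover have "p *s cvec w \<in> deriv_module F k"
        using homogeneous_mult_eq[OF p(1) homogeneous_const, of k] True
        by (auto simp: deriv_module_def forms3_def)
      moreover have "mult_poly = 1" by (simp add: mult_poly_def pts)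
      ultimately show ?thesis using p(2) g(2) by (intro image_eqI[of _ _ "p *s cvec w"]) simp_all
    next
      case False
      obtain \<theta> where "\<theta> \<in> deriv_module F k" "?f \<theta> = mult_poly * g"
        using image_surj[OF False k] g(1) unfolding N_def by blast
      then show ?thesis using g(2) by (intro image_eqI[of _ _ \<theta>]) simp_all
    qed
  qed
  have inj: "g = 0" if "mult_poly * g = 0" for g using that by simp
  have lin: "Vector_Spaces.linear Polynomial.smult Polynomial.smult (\<lambda>g. mult_poly * g)"
    by unfold_locales (simp_all add: algebra_simps)
  have "poly_vs.dim (?f ` deriv_module F k) = N"
    unfolding im using poly_poly.dim_image_inj[OF lin inj] dim_poly_below by auto
  then show ?thesis
    using S3_poly.rank_nullity(2)[OF linear_act fin_dim_deriv_module, of F k] N by (simp add: ker)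
qed

end

section \<open>Intersection points\<close>

lemma proj_point_iff: "proj_point P \<longleftrightarrow> (\<exists>p. p \<noteq> 0 \<and> P = vec.span {p})"
proof
  assume "proj_point P"
  then have P: "vec.subspace P" "vec.dim P = 1" by (auto simp: proj_point_def)
  obtain B where B: "B \<subseteq> P" "vec.independent B" "P \<subseteq> vec.span B" "card B = vec.dim P"
    using vec.basis_exists by blast
  then obtain p where p: "B = {p}" using P(2) by (metis card_1_singletonE)
  have "p \<noteq> 0" using B(2) by (simp add: p)
  moreover have "P = vec.span {p}"
    using B(1,3) P(1) by (simp add: p vec.span_minimal subset_antisym)
  ultimately show "\<exists>p. p \<noteq> 0 \<and> P = vec.span {p}" by blast
qed (auto simp: proj_point_def vec.dim_span)

lemma span_subset_zeros_iff: "vec.span {p} \<subseteq> zeros_linear_form b \<longleftrightarrow> dot b p = 0"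
proof
  assume "vec.span {p} \<subseteq> zeros_linear_form b"
  moreover have "p \<in> vec.span {p}" by (simp add: vec.span_base)
  ultimately show "dot b p = 0" by (auto simp: zeros_linear_form_dot)
qed (auto simp: zeros_linear_form_dot vec.span_singleton dot_scale_right)

lemma span_scaled: "c \<noteq> 0 \<Longrightarrow> vec.span {c *s p} = vec.span {p :: complex ^ 3}"
proof -
  assume c: "c \<noteq> 0"
  have "p = (1 / c) *s (c *s p)" using c by (simp add: vector_smult_assoc)
  then have "p \<in> vec.span {c *s p}" using vec.span_base vec.span_scale by (metis singletonI)
  moreover have "c *s p \<in> vec.span {p}" by (simp add: vec.span_base vec.span_scale)
  ultimately show ?thesis by (simp add: vec.span_minimal subset_antisym)
qed

definition multiple_points :: "(complex ^ 3) set set \<Rightarrow> (complex ^ 3) set set" where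
  "multiple_points \<A> = {P. proj_point P \<and> mult_at \<A> P \<ge> 2}"

definition points_on :: "(complex ^ 3) set set \<Rightarrow> (complex ^ 3) set \<Rightarrow> (complex ^ 3) set set" where
  "points_on \<A> L = {P. proj_point P \<and> P \<subseteq> L \<and> mult_at \<A> P \<ge> 1}"

text \<open>Points off \<open>L\<close> keep their multiplicity and points on it gain one. The
  condition \<open>g 1 = 0\<close> allows points that were simple before to be included in the old
  sum. It is applied to r - 1 and to r (r - 1).\<close>

lemma sum_multiple_points_insert:
  fixes g :: "nat \<Rightarrow> int"
  assumes A: "finite \<A>" "L \<notin> \<A>" and fin: "finite (multiple_points \<A>)" "finite (points_on \<A> L)"
    and g: "g 1 = 0"
  shows "finite (multiple_points (insert L \<A>))"
    and "(\<Sum>P\<in>multiple_points (insert L \<A>). g (mult_at (insert L \<A>) P)) =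
      (\<Sum>P\<in>multiple_points \<A>. g (mult_at \<A> P)) +
      (\<Sum>P\<in>points_on \<A> L. g (mult_at \<A> P + 1) - g (mult_at \<A> P))"
proof -
  let ?M = "multiple_points \<A>" and ?X = "points_on \<A> L"
  have mult: "mult_at (insert L \<A>) P = mult_at \<A> P + (if P \<subseteq> L then 1 else 0)" for P
  proof -
    have "{K \<in> insert L \<A>. P \<subseteq> K} = (if P \<subseteq> L then insert L {K \<in> \<A>. P \<subseteq> K} else {K \<in> \<A>. P \<subseteq> K})"
      by auto
    then show ?thesis using A by (simp add: mult_at_def)
  qed
  have eq: "multiple_points (insert L \<A>) = (?M - ?X) \<union> ?X"
    by (auto simp: multiple_points_def points_on_def mult split: if_splits)
  then show "finite (multiple_points (insert L \<A>))" using fin by simp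
  have "(\<Sum>P\<in>multiple_points (insert L \<A>). g (mult_at (insert L \<A>) P)) =
      (\<Sum>P\<in>?M - ?X. g (mult_at (insert L \<A>) P)) + (\<Sum>P\<in>?X. g (mult_at (insert L \<A>) P))"
    unfolding eq using fin by (intro sum.union_disjoint) auto
  also have "(\<Sum>P\<in>?M - ?X. g (mult_at (insert L \<A>) P)) = (\<Sum>P\<in>?M - ?X. g (mult_at \<A> P))"
    by (intro sum.cong) (auto simp: mult multiple_points_def points_on_def)
  also have "(\<Sum>P\<in>?X. g (mult_at (insert L \<A>) P)) =
      (\<Sum>P\<in>?X. g (mult_at \<A> P + 1) - g (mult_at \<A> P)) + (\<Sum>P\<in>?X. g (mult_at \<A> P))"
    by (simp add: sum_subtractf) (intro sum.cong, auto simp: mult points_on_def)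
  also have "(\<Sum>P\<in>?X. g (mult_at \<A> P)) = (\<Sum>P\<in>?M \<inter> ?X. g (mult_at \<A> P))"
  proof (intro sum.mono_neutral_right fin ballI)
    fix P assume "P \<in> ?X - ?M \<inter> ?X"
    then have "mult_at \<A> P = 1" by (auto simp: multiple_points_def points_on_def)
    then show "g (mult_at \<A> P) = 0" using g by simp
  qed auto
  finally show "(\<Sum>P\<in>multiple_points (insert L \<A>). g (mult_at (insert L \<A>) P)) =
      (\<Sum>P\<in>?M. g (mult_at \<A> P)) + (\<Sum>P\<in>?X. g (mult_at \<A> P + 1) - g (mult_at \<A> P))"
    using sum.Int_Diff[OF fin(1), of "\<lambda>P. g (mult_at \<A> P)" ?X] by simp
qed

text \<open>No line of \<open>F\<close> passes through \<open>v\<close>, so a point of the new line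
  on a line of \<open>F\<close> has nonzero coordinate along \<open>u\<close> and can be scaled to
  \<open>u + \<tau> v\<close>.\<close>

lemma (in adding_line) points_on_bij:
  assumes \<A>: "F = \<alpha> ` \<A>" "inj_on \<alpha> \<A>" "\<And>L. L \<in> \<A> \<Longrightarrow> L = zeros_linear_form (\<alpha> L)"
  shows "bij_betw (\<lambda>\<tau>. vec.span {u + \<tau> *s v}) points (points_on \<A> (zeros_linear_form a))"
    and "mult_at \<A> (vec.span {u + \<tau> *s v}) = card (through \<tau>)"
proof -
  have on: "dot b (u + \<tau> *s v) = 0 \<longleftrightarrow> point b = \<tau>" if "b \<in> F" for b \<tau>
    using v_off[OF that] by (auto simp: dot_add_right dot_scale_right dot_u)
  have nz: "u + \<tau> *s v \<noteq> 0" for \<tau>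
  proof
    assume "u + \<tau> *s v = 0"
    then have "dot \<mu> (u + \<tau> *s v) = 0" by simp
    then show False by (simp add: dot_add_right dot_scale_right \<mu>_u \<mu>_v)
  qed
  show mult: "mult_at \<A> (vec.span {u + \<tau> *s v}) = card (through \<tau>)" for \<tau>
  proof -
    have "{L \<in> \<A>. vec.span {u + \<tau> *s v} \<subseteq> L} = {L \<in> \<A>. point (\<alpha> L) = \<tau>}"
      using \<A>(1,3) on span_subset_zeros_iff[of "u + \<tau> *s v"] by (metis (no_types, lifting) imageI)
    moreover have "through \<tau> = \<alpha> ` {L \<in> \<A>. point (\<alpha> L) = \<tau>}"
      unfolding through_def by (auto simp: \<A>(1))
    moreover have "card (\<alpha> ` {L \<in> \<A>. point (\<alpha> L) = \<tau>}) = card {L \<in> \<A>. point (\<alpha> L) = \<tau>}"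
      using \<A>(2) by (intro card_image) (auto intro: inj_on_subset)
    ultimately show ?thesis by (simp add: mult_at_def)
  qed
  show "bij_betw (\<lambda>\<tau>. vec.span {u + \<tau> *s v}) points (points_on \<A> (zeros_linear_form a))"
    unfolding bij_betw_def
  proof (intro conjI inj_onI subset_antisym subsetI)
    fix \<tau> \<tau>' assume "\<tau> \<in> points" "vec.span {u + \<tau> *s v} = vec.span {u + \<tau>' *s v}"
    then obtain c where c: "u + \<tau> *s v = c *s (u + \<tau>' *s v)"
      by (metis (no_types, lifting) rangeE singletonI vec.span_base vec.span_singleton)
    from arg_cong[OF c, of "dot \<mu>"] arg_cong[OF c, of "dot \<nu>"] show "\<tau> = \<tau>'"
      by (simp add: dot_add_right dot_scale_right \<mu>_u \<mu>_v \<nu>_u \<nu>_v)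
  next
    fix P assume "P \<in> (\<lambda>\<tau>. vec.span {u + \<tau> *s v}) ` points"
    then obtain \<tau> where "\<tau> \<in> points" "P = vec.span {u + \<tau> *s v}" by auto
    then show "P \<in> points_on \<A> (zeros_linear_form a)"
      using nz card_through_pos mult
      by (auto simp: points_on_def proj_point_iff span_subset_zeros_iff dot_add_right dot_scale_right a_u a_v)
  next
    fix P assume P: "P \<in> points_on \<A> (zeros_linear_form a)"
    then obtain p where p: "p \<noteq> 0" "P = vec.span {p}" "dot a p = 0"
      by (auto simp: points_on_def proj_point_iff span_subset_zeros_iff)
    have "mult_at \<A> P \<noteq> 0" using P by (simp add: points_on_def)
    then have "{L \<in> \<A>. P \<subseteq> L} \<noteq> {}" unfolding mult_at_def by (metis card.empty)
    then obtain L where L: "L \<in> \<A>" "P \<subseteq> L" by auto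
    define b where "b = \<alpha> L"
    have b: "b \<in> F" "dot b p = 0"
      using L \<A>(1) \<A>(3)[OF L(1)] span_subset_zeros_iff[of p b] by (auto simp: p(2) b_def)
    define x y where "x = dot \<mu> p" and "y = dot \<nu> p"
    have pxy: "p = x *s u + y *s v" using line_point[OF p(3)] by (simp add: x_def y_def)
    have "dot b v * (y - point b * x) = 0"
      using b(2) v_off[OF b(1)] by (simp add: pxy dot_add_right dot_scale_right dot_u algebra_simps)
    then have "y = x * point b" using v_off[OF b(1)] by simp
    then have p': "p = x *s (u + point b *s v)"
      by (simp add: pxy vector_add_ldistrib vector_smult_assoc)
    then have "x \<noteq> 0" using p(1) by auto
    then have "P = vec.span {u + point b *s v}" unfolding p(2) p' by (rule span_scaled)
    then show "P \<in> (\<lambda>\<tau>. vec.span {u + \<tau> *s v}) ` points"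
      using b(1) by (auto simp: points_def)
  qed
qed

section \<open>The Hilbert function of the module of derivations\<close>

text \<open>Distinct planes of equal dimension are not contained in one another, and the zero form
  would define the whole space.\<close>

lemma arrangement_forms_image:
  assumes "line_arrangement \<A>" "\<And>L. L \<in> \<A> \<Longrightarrow> L = zeros_linear_form (\<alpha> L)"
  shows "inj_on \<alpha> \<A>" "arrangement_forms (\<alpha> ` \<A>)"
proof -
  have L: "vec.subspace L" "vec.dim L = 2" if "L \<in> \<A>" for L
    using assms(1) that by (auto simp: line_arrangement_def proj_line_def)
  show "inj_on \<alpha> \<A>" using assms(2) by (metis inj_onI)
  have nz: "\<alpha> L \<noteq> 0" if "L \<in> \<A>" for L
  proof
    assume "\<alpha> L = 0"
    then have "L = UNIV" using assms(2)[OF that] by (simp add: zeros_linear_form_dot)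
    moreover have "vec.dim (UNIV :: (complex ^ 3) set) = 3" by (simp only: vec_dim_card) simp
    ultimately show False using L(2)[OF that] by (metis numeral_eq_iff num.distinct(5))
  qed
  have "line_indep (\<alpha> L) (\<alpha> K)" if LK: "L \<in> \<A>" "K \<in> \<A>" "L \<noteq> K" for L K
  proof (rule ccontr)
    assume "\<not> line_indep (\<alpha> L) (\<alpha> K)"
    then have "zeros_linear_form (\<alpha> L) \<subseteq> zeros_linear_form (\<alpha> K)"
      by (auto simp: line_indep_def zeros_linear_form_dot)
    then have "L \<subseteq> K" using assms(2) LK by metis
    then have "L = K" using L[OF LK(1)] L[OF LK(2)] by (simp add: vec.subspace_dim_equal)
    then show False using LK(3) by simp
  qed
  then show "arrangement_forms (\<alpha> ` \<A>)"
    using nz assms(1) by (auto simp: arrangement_forms_def line_arrangement_def)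
qed

text \<open>Summed over points and not over multiplicities, so that the effect of an added line is
  the sum of local contributions on it.\<close>

definition b2 :: "(complex ^ 3) set set \<Rightarrow> int" where
  "b2 \<A> = (\<Sum>P\<in>multiple_points \<A>. int (mult_at \<A> P) - 1)"

text \<open>The second clause counts ordered pairs of distinct lines by their common point. In the
  third, each added line raises \<open>b2\<close> by its number of intersection points, the same
  number that enters the exact sequence.\<close>

lemma arrangement_hilbert_function:
  assumes "line_arrangement \<A>" "\<And>L. L \<in> \<A> \<Longrightarrow> L = zeros_linear_form (\<alpha> L)"
  shows "finite (multiple_points \<A>) \<and>
    (\<Sum>P\<in>multiple_points \<A>. int (mult_at \<A> P) * (int (mult_at \<A> P) - 1)) =
      int (card \<A>) * (int (card \<A>) - 1) \<and>
    (\<forall>k. k \<ge> 0 \<longrightarrow> k \<ge> int (card \<A>) - 3 \<longrightarrow>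
      2 * int (S3_vs.dim (deriv_module (\<alpha> ` \<A>) k)) =
      6 * hilb k - 2 * int (card \<A>) * (k + 1) + int (card \<A>) * (int (card \<A>) - 1) - 2 * b2 \<A>)"
proof -
  have "finite \<A>" using assms(1) by (simp add: line_arrangement_def)
  then show ?thesis using assms
  proof (induction \<A> rule: finite_induct)
    case empty
    have M: "multiple_points {} = {}" by (auto simp: multiple_points_def mult_at_def)
    have "deriv_module {} k = forms3 (\<lambda>_. k)" for k by (auto simp: deriv_module_def)
    then show ?case by (simp add: M b2_def dim_forms3)
  next
    case (insert L \<A>)
    have A: "line_arrangement \<A>" "\<And>L. L \<in> \<A> \<Longrightarrow> L = zeros_linear_form (\<alpha> L)"
      using insert.prems by (auto simp: line_arrangement_def)
    define F where "F = \<alpha> ` \<A>"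
    define a where "a = \<alpha> L"
    have inj: "inj_on \<alpha> (insert L \<A>)" and arr': "arrangement_forms (insert a F)"
      using arrangement_forms_image[OF insert.prems] by (auto simp: F_def a_def)
    have "a \<notin> F" using inj insert.hyps by (auto simp: F_def a_def)
    then have ind: "line_indep a b" if "b \<in> F" for b
      using arr' that by (auto simp: arrangement_forms_def)
    have arr: "arrangement_forms F" using arr' arrangement_forms_subset by blast
    then have "finite F" by (simp add: arrangement_forms_def)
    moreover have "a \<noteq> 0" using arr' by (simp add: arrangement_forms_def)
    ultimately obtain u v w \<mu> \<nu> where fr: "line_frame a u v w \<mu> \<nu>" "\<And>b. b \<in> F \<Longrightarrow> dot b v \<noteq> 0"
      using exists_line_frame[of a F] ind unfolding line_indep_def by metis
    interpret line_frame a u v w \<mu> \<nu> by fact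
    interpret adding_line a u v w \<mu> \<nu> F by unfold_locales (use arr fr(2) in auto)
    have La: "L = zeros_linear_form a" using insert.prems(2) by (simp add: a_def)
    have injA: "inj_on \<alpha> \<A>" using inj by (rule inj_on_subset) auto
    note bij = points_on_bij[OF F_def injA A(2)]
    have cardF: "card F = card \<A>" unfolding F_def by (rule card_image[OF injA])
    have fX: "finite (points_on \<A> L)"
      using bij_betw_finite[OF bij(1)] by (simp add: La)
    have cX: "card (points_on \<A> L) = card points"
      using bij_betw_same_card[OF bij(1)] by (simp add: La)
    have sX: "(\<Sum>P\<in>points_on \<A> L. mult_at \<A> P) = card \<A>"
    proof -
      have "(\<Sum>P\<in>points_on \<A> L. mult_at \<A> P) = (\<Sum>\<tau>\<in>points. mult_at \<A> (vec.span {u + \<tau> *s v}))"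
        unfolding La by (rule sum.reindex_bij_betw[OF bij(1), symmetric])
      then show ?thesis by (simp add: bij(2) sum_card_through cardF)
    qed
    note IH = insert.IH[OF A]
    note step = sum_multiple_points_insert[OF insert.hyps(1,2) _ fX]
    have b2: "b2 (insert L \<A>) = b2 \<A> + int (card points)"
      unfolding b2_def using step(2)[of "\<lambda>r. int r - 1"] IH by (simp add: cX)
    have "(\<Sum>P\<in>points_on \<A> L. (int (mult_at \<A> P) + 1) * int (mult_at \<A> P) -
        int (mult_at \<A> P) * (int (mult_at \<A> P) - 1)) = (\<Sum>P\<in>points_on \<A> L. 2 * int (mult_at \<A> P))"
      by (intro sum.cong) (auto simp: algebra_simps)
    also have "\<dots> = 2 * int (card \<A>)" by (simp add: sX flip: sum_distrib_left of_nat_sum)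
    finally have pairs: "(\<Sum>P\<in>multiple_points (insert L \<A>).
        int (mult_at (insert L \<A>) P) * (int (mult_at (insert L \<A>) P) - 1)) =
      int (card (insert L \<A>)) * (int (card (insert L \<A>)) - 1)"
      using step(2)[of "\<lambda>r. int r * (int r - 1)"] IH insert.hyps by (simp add: algebra_simps)
    have "2 * int (S3_vs.dim (deriv_module (\<alpha> ` insert L \<A>) k)) =
      6 * hilb k - 2 * int (card (insert L \<A>)) * (k + 1) +
      int (card (insert L \<A>)) * (int (card (insert L \<A>)) - 1) - 2 * b2 (insert L \<A>)"
      if k: "k \<ge> 0" "k \<ge> int (card (insert L \<A>)) - 3" for k
    proof -
      \<comment> \<open>The bound d - 3 for d lines is d' - 2 for the d' = d - 1 old ones, the range
        in which a line can be added; the induction hypothesis asks only for k \<ge> d' - 3.\<close>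
      have k': "k \<ge> int (card \<A>) - 2" using k(2) insert.hyps by simp
      have "\<alpha> ` insert L \<A> = insert a F" by (simp add: F_def a_def)
      then have "int (S3_vs.dim (deriv_module F k)) =
          int (S3_vs.dim (deriv_module (\<alpha> ` insert L \<A>) k)) + (k + 1 + int (card points) - int (card \<A>))"
        using dim_insert_line[of k] k(1) k' by (simp add: cardF)
      moreover have "2 * int (S3_vs.dim (deriv_module F k)) =
          6 * hilb k - 2 * int (card \<A>) * (k + 1) + int (card \<A>) * (int (card \<A>) - 1) - 2 * b2 \<A>"
        using IH k(1) k' by (simp add: F_def)
      ultimately show ?thesis using insert.hyps by (simp add: b2 algebra_simps)
    qed
    then show ?case using step(1)[of "\<lambda>r. int r - 1"] IH pairs by auto
  qed
qed

section \<open>Jacobian syzygies\<close>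

lemma partial_linear_form: "partial i (linear_form b) = const (vec_nth b i)"
proof -
  have "partial i (linear_form b) = (\<Sum>j\<in>UNIV. if i = j then const (vec_nth b j) else 0)"
    unfolding linear_form_def partial_sum partial_mult partial_const partial_var
    by (intro sum.cong) auto
  then show ?thesis by simp
qed

lemma partial_prod_linear_form:
  "finite F \<Longrightarrow> partial i (\<Prod>b\<in>F. linear_form b) = vec_nth (grad F) i"
proof (induction F rule: finite_induct)
  case (insert c F)
  have "(\<Sum>b\<in>F. (\<Prod>e\<in>insert c F - {b}. linear_form e) * const (vec_nth b i)) =
      (\<Sum>b\<in>F. linear_form c * ((\<Prod>e\<in>F - {b}. linear_form e) * const (vec_nth b i)))"
  proof (intro sum.cong refl)
    fix b assume "b \<in> F"
    then have "insert c F - {b} = insert c (F - {b})" using insert.hyps by auto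
    then show "(\<Prod>e\<in>insert c F - {b}. linear_form e) * const (vec_nth b i) =
        linear_form c * ((\<Prod>e\<in>F - {b}. linear_form e) * const (vec_nth b i))"
      using insert.hyps by (simp add: mult.assoc)
  qed
  moreover have "insert c F - {c} = F" using insert.hyps by auto
  ultimately show ?case
    using insert by (simp add: grad_nth partial_mult partial_linear_form sum_distrib_left mult_ac)
qed (simp add: grad_def)

lemma jacobian_ideal_eq: "jacobian_ideal f = range (dot (vec_lambda (\<lambda>i. partial i f)))"
proof (intro subset_antisym)
  have "S_ideal.subspace (range (dot (vec_lambda (\<lambda>i. partial i f))))"
    unfolding S_ideal.subspace_def
  proof (intro conjI ballI allI)
    show "0 \<in> range (dot (vec_lambda (\<lambda>i. partial i f)))" by (rule range_eqI[of _ _ 0]) simp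
    fix x y c assume "x \<in> range (dot (vec_lambda (\<lambda>i. partial i f)))"
    then obtain x' where x: "x = dot (vec_lambda (\<lambda>i. partial i f)) x'" by auto
    then show "c * x \<in> range (dot (vec_lambda (\<lambda>i. partial i f)))"
      by (intro range_eqI[of _ _ "c *s x'"]) (simp add: dot_scale_right)
    assume "y \<in> range (dot (vec_lambda (\<lambda>i. partial i f)))"
    then obtain y' where "y = dot (vec_lambda (\<lambda>i. partial i f)) y'" by auto
    with x show "x + y \<in> range (dot (vec_lambda (\<lambda>i. partial i f)))"
      by (intro range_eqI[of _ _ "x' + y'"]) (simp add: dot_add_right)
  qed
  moreover have "range (\<lambda>i. partial i f) \<subseteq> range (dot (vec_lambda (\<lambda>i. partial i f)))"
    by (intro image_subsetI range_eqI[of _ _ "axis i 1" for i])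
      (simp add: dot_def axis_def if_distrib if_distribR cong: if_cong)
  ultimately show "jacobian_ideal f \<subseteq> range (dot (vec_lambda (\<lambda>i. partial i f)))"
    unfolding jacobian_ideal_def by (intro S_ideal.span_minimal)
next
  show "range (dot (vec_lambda (\<lambda>i. partial i f))) \<subseteq> jacobian_ideal f"
  proof
    fix p assume "p \<in> range (dot (vec_lambda (\<lambda>i. partial i f)))"
    then obtain q where q: "p = (\<Sum>i\<in>UNIV. vec_nth q i * partial i f)"
      by (auto simp: dot_def mult.commute)
    show "p \<in> jacobian_ideal f"
      unfolding jacobian_ideal_def q
      by (rule S_ideal.span_sum, rule S_ideal.span_scale, rule S_ideal.span_base) simp
  qed
qed

text \<open>Taken for any vector \<open>g\<close>, since the generators of the Jacobian ideal in a
  resolution need not be the partial derivatives.\<close>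

definition syzygies :: "S ^ 3 \<Rightarrow> int \<Rightarrow> (S ^ 3) set" where
  "syzygies g k = {\<theta> \<in> forms3 (\<lambda>_. k). dot g \<theta> = 0}"

lemma linear_dot: "Vector_Spaces.linear (\<lambda>c v. const c *s v) (\<lambda>c p. const c * p) (dot g)"
  by unfold_locales (simp_all add: dot_add_right dot_scale_right)

text \<open>Rank-nullity shows that the dimension depends only on the graded piece of the ideal
  generated, although the syzygies themselves depend on the generators.\<close>

lemma dim_syzygies:
  "3 * hilb k = int (S3_vs.dim (syzygies g k)) + int (S_vs.dim (dot g ` forms3 (\<lambda>_. k)))"
  using S3_S.rank_nullity(2)[OF linear_dot[of g] fin_dim_forms3, of "\<lambda>_. k"] dim_forms3[of "\<lambda>_. k"]
  by (simp add: syzygies_def)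

lemma dot_grad_mod:
  assumes "finite F" "b \<in> F"
  shows "\<exists>r. dot (grad F) \<theta> = (\<Prod>c\<in>F - {b}. linear_form c) * dot (cvec b) \<theta> + linear_form b * r"
proof -
  obtain r where "grad F = (\<Prod>c\<in>F - {b}. linear_form c) *s cvec b + linear_form b *s r"
    using grad_mod[OF assms] by blast
  then show ?thesis by (auto simp: dot_add_left dot_scale_left)
qed

text \<open>Modulo the Euler derivation, the derivations of the arrangement are the Jacobian syzygies.\<close>

lemma dim_deriv_module_syzygies:
  assumes arr: "arrangement_forms F" and "F \<noteq> {}"
  shows "int (S3_vs.dim (deriv_module F k)) = int (S3_vs.dim (syzygies (grad F) k)) + hilb (k - 1)"
proof -
  define f where "f = (\<Prod>b\<in>F. linear_form b)"
  have fin: "finite F" using arr by (simp add: arrangement_forms_def)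
  have ker: "{\<theta> \<in> deriv_module F k. dot (grad F) \<theta> = 0} = syzygies (grad F) k"
  proof -
    have "linear_form b dvd dot (cvec b) \<theta>" if \<theta>: "\<theta> \<in> syzygies (grad F) k" and b: "b \<in> F" for \<theta> b
    proof -
      have "\<exists>x. dot b x = 0 \<and> dot c x \<noteq> 0" if "c \<in> F - {b}" for c
        using arr b that by (auto simp: arrangement_forms_def line_indep_def)
      moreover have "b \<noteq> 0" using arr b by (simp add: arrangement_forms_def)
      ultimately obtain u v w \<mu> \<nu> where fr: "line_frame b u v w \<mu> \<nu>"
        and v: "\<And>c. c \<in> F - {b} \<Longrightarrow> dot c v \<noteq> 0"
        using exists_line_frame[of b "F - {b}"] fin by (metis finite_Diff)
      interpret line_frame b u v w \<mu> \<nu> by fact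
      obtain r where "dot (grad F) \<theta> = (\<Prod>c\<in>F - {b}. linear_form c) * dot (cvec b) \<theta> + linear_form b * r"
        using dot_grad_mod[OF fin b] by blast
      then have "(\<Prod>c\<in>F - {b}. linear_form c) * dot (cvec b) \<theta> + linear_form b * r = 0"
        using \<theta> by (simp add: syzygies_def)
      \<comment> \<open>On the line \<open>b = 0\<close> only the summand of \<open>b\<close> in
        \<theta>(f) survives, and its cofactor does not vanish there; hence \<theta>(b)
        does.\<close>
      from arg_cong[OF this, of "line_res u v"]
      have "line_res u v (\<Prod>c\<in>F - {b}. linear_form c) * line_res u v (dot (cvec b) \<theta>) = 0"
        by (simp add: line_res_add line_res_mult a_u a_v)
      moreover have "line_res u v (\<Prod>c\<in>F - {b}. linear_form c) \<noteq> 0"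
        using v fin by (simp add: line_res_prod)
      moreover have "homogeneous k (dot (cvec b) \<theta>)"
        using \<theta> by (auto simp: syzygies_def intro: homogeneous_dot)
      ultimately show ?thesis using dvd_iff_line_res by auto
    qed
    then show ?thesis by (auto simp: deriv_module_def syzygies_def)
  qed
  have im: "dot (grad F) ` deriv_module F k = (\<lambda>q. f * q) ` forms (k - 1)"
  proof (intro subset_antisym subsetI)
    fix p assume "p \<in> dot (grad F) ` deriv_module F k"
    then obtain \<theta> where \<theta>: "\<theta> \<in> deriv_module F k" "p = dot (grad F) \<theta>" by auto
    have "linear_form b dvd p" if "b \<in> F" for b
      using dot_grad_mod[OF fin that, of \<theta>] \<theta> that by (auto simp: deriv_module_def)
    moreover have "homogeneous (int (card F) - 1 + k) p"
      unfolding \<theta>(2) dot_def using \<theta>(1) homogeneous_grad[OF fin \<open>F \<noteq> {}\<close>]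
      by (intro homogeneous_sum homogeneous_mult) (auto simp: deriv_module_def forms3_def)
    ultimately obtain q where "homogeneous (int (card F) - 1 + k - int (card F)) q" "p = f * q"
      using linear_form_prod_dvd[OF arr] unfolding f_def by blast
    then show "p \<in> (\<lambda>q. f * q) ` forms (k - 1)" by (auto simp: forms_def)
  next
    fix p assume "p \<in> (\<lambda>q. f * q) ` forms (k - 1)"
    then obtain q where q: "homogeneous (k - 1) q" "p = f * q" by (auto simp: forms_def)
    define E where "E = (vec_lambda var :: S ^ 3)"
    \<comment> \<open>The factor comes from Euler's relation E(f) = d f for d lines.\<close>
    define q' where "q' = const (1 / of_nat (card F)) * q"
    have "dot (grad F) E = (\<Sum>b\<in>F. (\<Prod>c\<in>F - {b}. linear_form c) * linear_form b)"
      by (simp add: grad_def dot_sum_left dot_scale_left E_def linear_form_dot)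
    also have "\<dots> = (\<Sum>b\<in>F. f)"
      unfolding f_def using fin by (intro sum.cong refl) (simp add: prod.remove mult.commute)
    also have "\<dots> = const (of_nat (card F)) * f"
      by (simp add: const_def single_of_nat)
    finally have "dot (grad F) (q' *s E) = const (1 / of_nat (card F)) * const (of_nat (card F)) * (f * q)"
      by (simp only: dot_scale_right q'_def mult_ac)
    also have "const (1 / of_nat (card F)) * const (of_nat (card F)) = const (1 / of_nat (card F) * of_nat (card F))"
      by (simp only: const_hom)
    also have "\<dots> = 1" using fin \<open>F \<noteq> {}\<close> by (simp del: const_hom(4))
    finally have "dot (grad F) (q' *s E) = p" by (simp add: q(2))
    moreover have "q' *s E \<in> deriv_module F k"
    proof -
      have "homogeneous (k - 1) q'" unfolding q'_def by (rule homogeneous_const_mult[OF q(1)])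
      from homogeneous_mult_eq[OF this homogeneous_var, of k]
      show ?thesis by (simp add: deriv_module_def forms3_def E_def dot_scale_right linear_form_dot)
    qed
    ultimately show "p \<in> dot (grad F) ` deriv_module F k" by (intro image_eqI[of _ _ "q' *s E"]) simp_all
  qed
  have "linear_form b \<noteq> 0" if "b \<in> F" for b
  proof
    assume l: "linear_form b = 0"
    have "b \<noteq> 0" using arr that by (simp add: arrangement_forms_def)
    then obtain i where i: "vec_nth b i \<noteq> 0"
      by (auto simp: Finite_Cartesian_Product.vec_eq_iff)
    from arg_cong[OF l, of "line_res (axis i 1) 0"] i show False by simp
  qed
  then have "f \<noteq> 0" using fin by (simp add: f_def)
  then have inj: "q = 0" if "f * q = 0" for q using that by simp
  have "S_vs.dim ((\<lambda>q. f * q) ` forms (k - 1)) = S_vs.dim (forms (k - 1))"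
    using inj by (intro S_S.dim_image_inj[OF linear_mult_S _ fin_dim_forms])
  then show ?thesis
    using S3_S.rank_nullity(2)[OF linear_dot[of "grad F"] fin_dim_deriv_module, of F k] dim_forms[of "k - 1"]
    by (simp add: ker im)
qed

section \<open>Hilbert function from a resolution\<close>

definition hom_part3 :: "(3 \<Rightarrow> int) \<Rightarrow> S ^ 3 \<Rightarrow> S ^ 3" where
  "hom_part3 n v = vec_lambda (\<lambda>i. hom_part (n i) (vec_nth v i))"

lemma hom_part3_forms3 [simp]: "hom_part3 n v \<in> forms3 n"
  by (simp add: forms3_def hom_part3_def)

lemma hom_part_dot:
  assumes "\<And>i. homogeneous (n i) (vec_nth g i)"
  shows "hom_part k (dot g v) = dot g (hom_part3 (\<lambda>i. k - n i) v)"
  by (simp add: dot_def hom_part_sum hom_part_mult[OF assms] hom_part3_def)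

text \<open>An element of both ideals may have inhomogeneous coefficients with respect to
  \<open>h\<close>; projecting these to degree k leaves the element unchanged. So graded pieces
  depend only on the ideal.\<close>

lemma dot_image_subset:
  assumes g: "\<And>i. homogeneous n (vec_nth g i)" and h: "\<And>i. homogeneous n (vec_nth h i)"
    and sub: "range (dot g) \<subseteq> range (dot h)"
  shows "dot g ` forms3 (\<lambda>_. k) \<subseteq> dot h ` forms3 (\<lambda>_. k)"
proof
  fix p assume "p \<in> dot g ` forms3 (\<lambda>_. k)"
  then obtain v where v: "v \<in> forms3 (\<lambda>_. k)" "p = dot g v" by auto
  have hp: "homogeneous (n + k) p"
    unfolding v(2) dot_def using v(1) g by (auto simp: forms3_def intro!: homogeneous_sum homogeneous_mult)
  obtain w where w: "p = dot h w" using sub v(2) by blast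
  have "p = hom_part (n + k) p" using hp by (simp add: hom_part_homogeneous)
  also have "\<dots> = dot h (hom_part3 (\<lambda>_. k) w)"
    unfolding w using hom_part_dot[OF h, of "n + k" w] by simp
  finally show "p \<in> dot h ` forms3 (\<lambda>_. k)" by (intro image_eqI[of _ _ "hom_part3 (\<lambda>_. k) w"]) simp_all
qed

definition mat_act :: "(3 \<Rightarrow> 3 \<Rightarrow> S) \<Rightarrow> S ^ 3 \<Rightarrow> S ^ 3" where
  "mat_act B w = vec_lambda (\<lambda>i. \<Sum>j\<in>UNIV. B i j * vec_nth w j)"

lemma mat_act_nth: "vec_nth (mat_act B w) i = dot (vec_lambda (B i)) w"
  by (simp add: mat_act_def dot_def)

text \<open>Dimensions in degree k of the exact sequence 0 -> S(-e) -> S(-D 1) + S(-D 2) + S(-D 3)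
  -> Syz(g) -> 0. Exactness is assumed without grading, so preimages are projected to the right
  degrees.\<close>

lemma dim_syzygies_resolution:
  fixes D :: "3 \<Rightarrow> int"
  assumes B: "\<And>i j. homogeneous (D j) (B i j)" and C: "\<And>i. homogeneous (e - D i) (vec_nth C i)"
    and syz: "\<And>v. dot g v = 0 \<longleftrightarrow> (\<exists>w. v = mat_act B w)"
    and syz2: "\<And>w. mat_act B w = 0 \<longleftrightarrow> (\<exists>q. w = q *s C)"
    and inj: "\<And>q. q *s C = 0 \<Longrightarrow> q = 0"
  shows "int (S3_vs.dim (syzygies g k)) = (\<Sum>i\<in>UNIV. hilb (k - D i)) - hilb (k - e)"
proof -
  have linB: "Vector_Spaces.linear (\<lambda>c v. const c *s v) (\<lambda>c v. const c *s v) (mat_act B)"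
    by unfold_locales
      (simp_all add: Finite_Cartesian_Product.vec_eq_iff mat_act_nth dot_add_right dot_scale_right)
  have linC: "Vector_Spaces.linear (\<lambda>c p. const c * p) (\<lambda>c v. const c *s v) (\<lambda>q. q *s C)"
    by unfold_locales (simp_all add: vector_sadd_rdistrib vector_smult_assoc)
  let ?V = "forms3 (\<lambda>i. k - D i)"
  have homB: "hom_part3 (\<lambda>_. k) (mat_act B w) = mat_act B (hom_part3 (\<lambda>i. k - D i) w)" for w
  proof -
    have "hom_part k (dot (vec_lambda (B i)) w) = dot (vec_lambda (B i)) (hom_part3 (\<lambda>i. k - D i) w)" for i
      using B by (intro hom_part_dot) simp
    then show ?thesis
      by (simp add: Finite_Cartesian_Product.vec_eq_iff mat_act_nth hom_part3_def[of "\<lambda>_. k"])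
  qed
  have im: "mat_act B ` ?V = syzygies g k"
  proof (intro subset_antisym subsetI)
    fix v assume "v \<in> mat_act B ` ?V"
    then obtain w where w: "w \<in> ?V" "v = mat_act B w" by auto
    have "homogeneous k (vec_nth v i)" for i
      unfolding w(2) mat_act_nth dot_def using w(1) B
      by (intro homogeneous_sum homogeneous_mult_eq[of "D j" _ "k - D j" for j]) (auto simp: forms3_def)
    then show "v \<in> syzygies g k" using syz w(2) by (auto simp: syzygies_def forms3_def)
  next
    fix v assume v: "v \<in> syzygies g k"
    then obtain w where w: "v = mat_act B w" using syz by (auto simp: syzygies_def)
    have "hom_part3 (\<lambda>_. k) v = v"
      using v by (simp add: syzygies_def forms3_def hom_part3_def hom_part_homogeneous
          Finite_Cartesian_Product.vec_eq_iff)
    then have "v = mat_act B (hom_part3 (\<lambda>i. k - D i) w)" using homB[of w] by (simp add: w)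
    then show "v \<in> mat_act B ` ?V" by (rule image_eqI) simp
  qed
  have ker: "{w \<in> ?V. mat_act B w = 0} = (\<lambda>q. q *s C) ` forms (k - e)"
  proof (intro subset_antisym subsetI)
    fix w assume w: "w \<in> {w \<in> ?V. mat_act B w = 0}"
    then obtain q where q: "w = q *s C" using syz2 by auto
    have "w = hom_part (k - e) q *s C"
    proof -
      have "vec_nth w i = hom_part (k - D i) (vec_nth C i * q)" for i
        using w hom_part_homogeneous[of "k - D i" "vec_nth w i"] by (simp add: forms3_def q mult.commute)
      also have "hom_part (k - D i) (vec_nth C i * q) = vec_nth C i * hom_part (k - e) q" for i
        using hom_part_mult[OF C[of i], of "k - D i" q] by simp
      finally show ?thesis by (simp add: Finite_Cartesian_Product.vec_eq_iff mult.commute)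
    qed
    then show "w \<in> (\<lambda>q. q *s C) ` forms (k - e)"
      by (rule image_eqI) (simp add: forms_def)
  next
    fix w assume "w \<in> (\<lambda>q. q *s C) ` forms (k - e)"
    then obtain q where q: "homogeneous (k - e) q" "w = q *s C" by (auto simp: forms_def)
    have "homogeneous (k - D i) (q * vec_nth C i)" for i
      by (rule homogeneous_mult_eq[OF q(1) C]) simp
    then show "w \<in> {w \<in> ?V. mat_act B w = 0}"
      using syz2 q(2) by (auto simp: forms3_def)
  qed
  have "S3_vs.dim ((\<lambda>q. q *s C) ` forms (k - e)) = S_vs.dim (forms (k - e))"
    using inj by (intro S_S3.dim_image_inj[OF linC _ fin_dim_forms])
  then show ?thesis
    using S3_S3.rank_nullity(2)[OF linB fin_dim_forms3, of "\<lambda>i. k - D i"]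
      dim_forms3[of "\<lambda>i. k - D i"] dim_forms[of "k - e"]
    by (simp add: im ker)
qed

section \<open>From matrices over S to vectors indexed by the type 3\<close>

definition idx :: "3 \<Rightarrow> nat" where "idx i = (if i = 1 then 0 else if i = 2 then 1 else 2)"

lemma idx_simps [simp]: "idx 1 = 0" "idx 2 = 1" "idx 3 = 2" "idx i < 3"
  by (simp_all add: idx_def)

definition to_vec3 :: "S ^ 3 \<Rightarrow> S Matrix.vec" where
  "to_vec3 v = Matrix.vec 3 (\<lambda>j. if j = 0 then vec_nth v 1 else if j = 1 then vec_nth v 2 else vec_nth v 3)"

lemma to_vec3_carrier [simp]: "to_vec3 v \<in> carrier_vec 3"
  by (simp add: to_vec3_def)

lemma to_vec3_idx [simp]: "to_vec3 v $ idx i = vec_nth v i"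
  using exhaust_3[of i] by (elim disjE) (simp_all add: to_vec3_def)

lemma vec3_eqI:
  assumes "x \<in> carrier_vec 3" "y \<in> carrier_vec 3" "\<And>i. x $ idx i = y $ idx i"
  shows "x = y"
proof (rule eq_vecI)
  fix j assume "j < dim_vec y"
  then have "j = idx 1 \<or> j = idx 2 \<or> j = idx 3" using assms(2) by auto
  then show "x $ j = y $ j" using assms(3) by metis
qed (use assms in auto)

lemma to_vec3_surj:
  assumes "x \<in> carrier_vec 3"
  shows "x = to_vec3 (vec_lambda (\<lambda>i. x $ idx i))"
  by (rule vec3_eqI[OF assms]) simp_all

lemma to_vec3_inject: "to_vec3 v = to_vec3 w \<longleftrightarrow> v = w"
proof
  assume eq: "to_vec3 v = to_vec3 w"
  have "vec_nth v i = vec_nth w i" for i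
    unfolding to_vec3_idx[symmetric] eq by (rule refl)
  then show "v = w" by (simp add: Finite_Cartesian_Product.vec_eq_iff)
qed simp

lemma mult_mat_vec3:
  assumes "M \<in> carrier_mat m 3" "i < m"
  shows "(M *\<^sub>v to_vec3 v) $ i = (\<Sum>j\<in>UNIV. M $$ (i, idx j) * vec_nth v j)"
proof -
  have "{0..<3} = {0, 1, 2 :: nat}" by auto
  then show ?thesis
    using assms by (simp add: scalar_prod_def sum_3 to_vec3_def algebra_simps)
qed

lemma mult_mat_vec1:
  assumes "M \<in> carrier_mat m 1" "i < m" "x \<in> carrier_vec 1"
  shows "(M *\<^sub>v x) $ i = M $$ (i, 0) * x $ 0"
  using assms by (simp add: scalar_prod_def)

text \<open>Subtracting the common twist \<open>N\<close> turns the degrees of the columns of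
  \<open>B\<close> into the exponents. The sole generator of the last module becomes the vector
  \<open>C\<close>.\<close>

lemma min_resolution_triple:
  fixes D :: "3 \<Rightarrow> nat"
  assumes "has_min_graded_resolution I (replicate 3 N) (map (\<lambda>x. N + int x) [D 1, D 2, D 3]) [e]"
  obtains g :: "S ^ 3" and B :: "3 \<Rightarrow> 3 \<Rightarrow> S" and C :: "S ^ 3" where
    "\<And>i. homogeneous N (vec_nth g i)" "\<And>i j. homogeneous (int (D j)) (B i j)"
    "\<And>i. homogeneous (e - N - int (D i)) (vec_nth C i)"
    "range (dot g) = I" "\<And>v. dot g v = 0 \<longleftrightarrow> (\<exists>w. v = mat_act B w)"
    "\<And>w. mat_act B w = 0 \<longleftrightarrow> (\<exists>q. w = q *s C)" "\<And>q. q *s C = 0 \<Longrightarrow> q = 0"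
proof -
  let ?bs = "map (\<lambda>x. N + int x) [D 1, D 2, D 3]"
  obtain MA MB MC where gh: "graded_hom (replicate 3 N) [0] MA" "graded_hom ?bs (replicate 3 N) MB"
      "graded_hom [e] ?bs MC"
    and I: "mat_image MA = {v \<in> carrier_vec 1. v $ 0 \<in> I}"
    and ex: "mat_kernel MA = mat_image MB" "mat_kernel MB = mat_image MC" "mat_kernel MC = {0\<^sub>v 1}"
    using assms unfolding has_min_graded_resolution_def by auto
  have dims: "MA \<in> carrier_mat 1 3" "MB \<in> carrier_mat 3 3" "MC \<in> carrier_mat 3 1"
    using gh by (auto simp: graded_hom_def eval_nat_numeral)
  have bs: "?bs ! idx i = N + int (D i)" for i
    using exhaust_3[of i] by (elim disjE) simp_all
  have len3: "idx i < length (replicate 3 N)" "idx i < length ?bs" for i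
    by (simp_all add: idx_def)
  define g :: "S ^ 3" where "g = vec_lambda (\<lambda>i. MA $$ (0, idx i))"
  define B where "B i j = MB $$ (idx i, idx j)" for i j
  define C :: "S ^ 3" where "C = vec_lambda (\<lambda>i. MC $$ (idx i, 0))"
  have A_act: "(MA *\<^sub>v to_vec3 v) $ 0 = dot g v" for v
    using mult_mat_vec3[OF dims(1), of 0 v] by (simp add: g_def dot_def)
  have B_act: "MB *\<^sub>v to_vec3 w = to_vec3 (mat_act B w)" for w
    using dims(2) mult_mat_vec3[OF dims(2), of "idx i" w for i]
    by (intro vec3_eqI) (simp_all add: mat_act_def B_def)
  have C_act: "MC *\<^sub>v x = to_vec3 (x $ 0 *s C)" if "x \<in> carrier_vec 1" for x
    using mult_mat_vec_carrier[OF dims(3) that] mult_mat_vec1[OF dims(3) _ that, of "idx i" for i]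
    by (intro vec3_eqI) (simp_all add: C_def mult.commute del: index_mult_mat_vec)
  have carr3: "(\<exists>x\<in>carrier_vec 3. P x) \<longleftrightarrow> (\<exists>v. P (to_vec3 v))" for P
    using to_vec3_surj to_vec3_carrier by metis
  have zero3: "0\<^sub>v 3 = to_vec3 0" by (rule vec3_eqI) (simp_all add: to_vec3_def)
  have kerA: "to_vec3 v \<in> mat_kernel MA \<longleftrightarrow> dot g v = 0" for v
  proof -
    have "MA *\<^sub>v to_vec3 v = 0\<^sub>v 1 \<longleftrightarrow> (MA *\<^sub>v to_vec3 v) $ 0 = 0"
      using dims(1) by (auto simp: Matrix.vec_eq_iff)
    then show ?thesis using dims(1) by (simp add: mat_kernel_def A_act)
  qed
  have kerB: "to_vec3 w \<in> mat_kernel MB \<longleftrightarrow> mat_act B w = 0" for w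
    using dims(2) by (simp add: mat_kernel_def B_act zero3 to_vec3_inject)
  have imB: "to_vec3 v \<in> mat_image MB \<longleftrightarrow> (\<exists>w. v = mat_act B w)" for v
    using dims(2) carr3[of "\<lambda>x. to_vec3 v = MB *\<^sub>v x"]
    by (simp add: mat_image_def image_iff B_act to_vec3_inject)
  have imC: "to_vec3 w \<in> mat_image MC \<longleftrightarrow> (\<exists>q. w = q *s C)" for w
  proof -
    have "to_vec3 w \<in> mat_image MC \<longleftrightarrow> (\<exists>x\<in>carrier_vec 1. w = x $ 0 *s C)"
      using dims(3) by (auto simp: mat_image_def image_iff C_act to_vec3_inject)
    also have "\<dots> \<longleftrightarrow> (\<exists>q. w = q *s C)"
    proof
      assume "\<exists>q. w = q *s C"
      then obtain q where "w = q *s C" ..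
      then show "\<exists>x\<in>carrier_vec 1. w = x $ 0 *s C"
        by (intro bexI[of _ "Matrix.vec 1 (\<lambda>_. q)"]) simp_all
    qed auto
    finally show ?thesis .
  qed
  show thesis
  proof
    show "homogeneous N (vec_nth g i)" for i
      using gh(1) by (simp add: graded_hom_def g_def)
    show "homogeneous (int (D j)) (B i j)" for i j
    proof -
      have "homogeneous (?bs ! idx j - replicate 3 N ! idx i) (MB $$ (idx i, idx j))"
        using gh(2) len3 unfolding graded_hom_def by blast
      then show ?thesis by (simp add: bs B_def del: list.map)
    qed
    show "homogeneous (e - N - int (D i)) (vec_nth C i)" for i
    proof -
      have "homogeneous ([e] ! 0 - ?bs ! idx i) (MC $$ (idx i, 0))"
        using gh(3) len3(2)[of i] unfolding graded_hom_def by (metis length_Cons list.size(3) zero_less_Suc)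
      then show ?thesis by (simp add: bs C_def diff_diff_eq del: list.map)
    qed
    show "range (dot g) = I"
    proof (intro subset_antisym subsetI)
      fix p assume "p \<in> range (dot g)"
      then obtain v where v: "p = dot g v" by auto
      have "MA *\<^sub>v to_vec3 v \<in> mat_image MA" using dims(1) by (auto simp: mat_image_def)
      then show "p \<in> I" unfolding I by (simp add: A_act v)
    next
      fix p assume "p \<in> I"
      then have "Matrix.vec 1 (\<lambda>_. p) \<in> mat_image MA" unfolding I by simp
      then obtain x where x: "x \<in> carrier_vec 3" "Matrix.vec 1 (\<lambda>_. p) = MA *\<^sub>v x"
        using dims(1) by (auto simp: mat_image_def)
      have "p = (MA *\<^sub>v x) $ 0" by (simp flip: x(2))
      also have "x = to_vec3 (vec_lambda (\<lambda>i. x $ idx i))" using x(1) by (rule to_vec3_surj)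
      finally show "p \<in> range (dot g)" by (simp add: A_act)
    qed
    show "dot g v = 0 \<longleftrightarrow> (\<exists>w. v = mat_act B w)" for v
      using kerA[of v] imB[of v] ex(1) by simp
    show "mat_act B w = 0 \<longleftrightarrow> (\<exists>q. w = q *s C)" for w
      using kerB[of w] imC[of w] ex(2) by simp
    show "q = 0" if q: "q *s C = 0" for q
    proof -
      have "MC *\<^sub>v Matrix.vec 1 (\<lambda>_. q) = to_vec3 (q *s C)"
        using C_act[of "Matrix.vec 1 (\<lambda>_. q)"] by simp
      then have "MC *\<^sub>v Matrix.vec 1 (\<lambda>_. q) = 0\<^sub>v 3" by (simp only: q zero3)
      then have "Matrix.vec 1 (\<lambda>_. q) \<in> mat_kernel MC" using dims(3) by (simp add: mat_kernel_def)
      then have "Matrix.vec 1 (\<lambda>_. q) $ 0 = 0\<^sub>v 1 $ 0" using ex(3) by simp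
      then show ?thesis by simp
    qed
  qed
qed

section \<open>Numerical consequences\<close>

text \<open>In large degrees \<open>hf\<close> is an identity of polynomials in k, which determines
  \<open>e\<close> and \<open>b\<close>. The bound on \<open>d3\<close> comes from one small degree
  in which \<open>hf\<close> still holds but the polynomial identity would need a different value of
  \<open>hilb\<close>.\<close>

lemma plus_one_generated_numerics:
  fixes d1 d2 d3 :: nat and d b e :: int
  assumes d: "int d1 + int d2 = d" and le: "1 \<le> d1" "d1 \<le> d2" "d2 \<le> d3"
    and b_le: "2 * b \<le> d * (d - 1)"
    and hf: "\<And>k. k \<ge> 0 \<Longrightarrow> k \<ge> d - 3 \<Longrightarrow>
      2 * (hilb (k - 1) + hilb (k - d1) + hilb (k - d2) + hilb (k - d3) - hilb (k - e)) =
      6 * hilb k - 2 * d * (k + 1) + d * (d - 1) - 2 * b"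
  shows "b = int d1 * int d2 + int d3" "int d3 \<le> d - 2"
proof -
  define K where "K = \<bar>e\<bar> + int d1 + int d2 + int d3 + \<bar>d\<bar>"
  have E: "k * (k + 1) + (k - d1 + 1) * (k - d1 + 2) + (k - d2 + 1) * (k - d2 + 2)
      + (k - d3 + 1) * (k - d3 + 2) - (k - e + 1) * (k - e + 2) =
      3 * ((k + 1) * (k + 2)) - 2 * d * (k + 1) + d * (d - 1) - 2 * b" if "k \<ge> K" for k
  proof -
    have "k \<ge> 0" "k \<ge> d - 3" "k - e \<ge> -2" "k - d1 \<ge> -2" "k - d2 \<ge> -2" "k - d3 \<ge> -2"
      using that by (auto simp: K_def)
    then show ?thesis
      using hf[of k] hilb_double[of k] hilb_double[of "k - 1"] hilb_double[of "k - e"]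
        hilb_double[of "k - d1"] hilb_double[of "k - d2"] hilb_double[of "k - d3"]
      by (simp add: add.commute)
  qed
  \<comment> \<open>The quadratic terms cancel and the linear ones determine \<open>e\<close>, so
    two consecutive degrees suffice.\<close>
  have e: "e = int d3 + 1"
    using E[of K] E[of "K + 1"] d[symmetric] by (simp add: algebra_simps)
  show b: "b = int d1 * int d2 + int d3"
    using E[of K] d[symmetric] by (simp add: e algebra_simps)
  show "int d3 \<le> d - 2"
  proof (rule ccontr)
    assume "\<not> int d3 \<le> d - 2"
    then have d3: "int d3 \<ge> d - 1" by simp
    show False
    proof (cases "d3 = 1")
      case True
      \<comment> \<open>The degree d3 - 2 would be negative here. The exponents give b = 2 and d =
        2, against 2 b \<le> d (d - 1).\<close>
      then have "d1 = 1" "d2 = 1" using le by auto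
      then show False using b_le b d True by simp
    next
      case False
      \<comment> \<open>Here \<open>k - e\<close> is -3, the only argument below -2:
        \<open>hilb\<close> is 0 there, while its polynomial is 1.\<close>
      define k where "k = int d3 - 2"
      have k: "k \<ge> 0" "k \<ge> d - 3" using False le d3 by (auto simp: k_def)
      have "hilb (k - e) = 0" by (simp add: k_def e hilb_def)
      moreover have "k - d1 \<ge> -2" "k - d2 \<ge> -2" "k - d3 \<ge> -2" using le by (auto simp: k_def)
      ultimately show False
        using hf[OF k] hilb_double[of k] hilb_double[of "k - 1"] k
          hilb_double[of "k - d1"] hilb_double[of "k - d2"] hilb_double[of "k - d3"] d[symmetric]
        by (simp add: k_def b algebra_simps)
    qed
  qed
qed

text \<open>
  For \<open>m \<ge> 4\<close> the bound follows from \<open>d \<le> 2 d\<^sub>3\<close>, and for \<open>m \<le> 3\<close> from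
  \<open>m b \<ge> d (d - 1)\<close>.
\<close>

lemma exponent_lower_bound:
  fixes d1 d2 d3 m :: int
  assumes d: "d1 + d2 = d" and le: "1 \<le> d1" "d1 \<le> d2" "d2 \<le> d3" and m: "m \<ge> 2"
    and b: "d * (d - 1) \<le> m * (d1 * d2 + d3)"
  shows "2 * d \<le> m * (d3 + 2)"
proof (rule ccontr)
  assume "\<not> 2 * d \<le> m * (d3 + 2)"
  then have lt: "m * (d3 + 2) < 2 * d" by simp
  have d3: "d \<le> 2 * d3" using d le by simp
  have "m < 4"
  proof (rule ccontr)
    assume "\<not> m < 4"
    then have "4 * (d3 + 2) \<le> m * (d3 + 2)" using le by (intro mult_right_mono) auto
    then show False using lt d3 by simp
  qed
  then consider "m = 2" | "m = 3" using m by linarith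
  moreover have sq: "4 * (d1 * d2) \<le> d * d"
    using d[symmetric] zero_le_square[of "d1 - d2"] by (simp add: algebra_simps)
  ultimately show False
  proof cases
    case 1
    have "d3 \<le> d - 3" using lt 1 by simp
    have "4 * (d * (d - 1)) \<le> 2 * (4 * (d1 * d2)) + 8 * d3" using b 1 by simp
    also have "\<dots> \<le> 2 * (d * d) + 8 * (d - 3)" using sq \<open>d3 \<le> d - 3\<close> by simp
    finally have "2 * ((d - 3) * (d - 3)) + 6 \<le> 0" by (simp add: algebra_simps)
    then show False using zero_le_square[of "d - 3"] by linarith
  next
    case 2
    have "3 * d3 \<le> 2 * d - 7" using lt 2 by simp
    have "4 * (d * (d - 1)) \<le> 3 * (4 * (d1 * d2)) + 12 * d3" using b 2 by simp
    also have "\<dots> \<le> 3 * (d * d) + 4 * (2 * d - 7)" using sq \<open>3 * d3 \<le> 2 * d - 7\<close> by simp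
    finally have "d * d \<le> 12 * d - 28" by (simp add: algebra_simps)
    \<comment> \<open>Together with d \<le> 2 d3 this is 3 d \<le> 6 d3 \<le> 4 d - 14.\<close>
    moreover have "d \<ge> 14" using d3 \<open>3 * d3 \<le> 2 * d - 7\<close> by simp
    then have "14 * d \<le> d * d" by (intro mult_right_mono) auto
    ultimately show False using \<open>d \<ge> 14\<close> by simp
  qed
qed

lemma b2_t_num:
  assumes "finite \<A>" "finite (multiple_points \<A>)"
  shows "(\<Sum>r = 2..card \<A>. (int r - 1) * int (t_num \<A> r)) = b2 \<A>"
proof -
  have "mult_at \<A> P \<le> card \<A>" for P
    unfolding mult_at_def using assms(1) by (intro card_mono) auto
  then have img: "mult_at \<A> ` multiple_points \<A> \<subseteq> {2..card \<A>}"
    by (auto simp: multiple_points_def)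
  have "b2 \<A> = (\<Sum>r\<in>{2..card \<A>}. \<Sum>P\<in>{P \<in> multiple_points \<A>. mult_at \<A> P = r}. int (mult_at \<A> P) - 1)"
    unfolding b2_def by (rule sum.group[symmetric, OF assms(2) _ img]) simp
  also have "\<dots> = (\<Sum>r = 2..card \<A>. (int r - 1) * int (t_num \<A> r))"
  proof (intro sum.cong refl)
    fix r assume "r \<in> {2..card \<A>}"
    then have "{P \<in> multiple_points \<A>. mult_at \<A> P = r} = {P. proj_point P \<and> mult_at \<A> P = r}"
      by (auto simp: multiple_points_def)
    moreover have "(\<Sum>P\<in>{P \<in> multiple_points \<A>. mult_at \<A> P = r}. int (mult_at \<A> P) - 1) =
        (\<Sum>P\<in>{P \<in> multiple_points \<A>. mult_at \<A> P = r}. int r - 1)"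
      by (intro sum.cong) auto
    ultimately show "(\<Sum>P\<in>{P \<in> multiple_points \<A>. mult_at \<A> P = r}. int (mult_at \<A> P) - 1) =
        (int r - 1) * int (t_num \<A> r)"
      by (simp add: t_num_def mult.commute)
  qed
  finally show ?thesis by simp
qed

theorem theorem4p2:
  fixes \<L> :: "(complex ^ 3) set set" and f :: S and d :: nat
  assumes "line_arrangement \<L>" and "card \<L> = d"
    and "defining_polynomial \<L> f"
    and "\<not> free_curve f"
    and "\<forall>h \<in> {\<lceil>2 * real d / real (max_mult \<L>) - 2\<rceil> .. int d - 2}.
           \<not> splits_over_rationals (P_poly \<L> h)"
  shows "\<not> plus_one_generated d f"
proof
  assume "plus_one_generated d f"
  then obtain d1 d2 d3 where syz: "syzygy_curve d f [d1, d2, d3]" and d12: "d1 + d2 = d"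
    by (auto simp: plus_one_generated_def plus_one_generated_with_def)
  have le: "1 \<le> d1" "d1 \<le> d2" "d2 \<le> d3"
    using syz by (auto simp: syzygy_curve_def)
  obtain es where "length [d1, d2, d3] = length es + 2" and res_es: "has_min_graded_resolution
      (jacobian_ideal f) (replicate 3 (int d - 1)) (map (\<lambda>x. int d - 1 + int x) [d1, d2, d3]) es"
    using syz unfolding syzygy_curve_def by blast
  then have "length es = 1" by simp
  then obtain e where es: "es = [e]" by (auto simp: length_Suc_conv)
  define D where "D i = [d1, d2, d3] ! idx i" for i
  have D: "D 1 = d1" "D 2 = d2" "D 3 = d3" by (simp_all add: D_def)
  have res: "has_min_graded_resolution (jacobian_ideal f) (replicate 3 (int d - 1))
      (map (\<lambda>x. int d - 1 + int x) [D 1, D 2, D 3]) [e]"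
    unfolding D es[symmetric] by (rule res_es)
  from min_resolution_triple[OF res] obtain g B C where
      g: "\<And>i. homogeneous (int d - 1) (vec_nth g i)" and B: "\<And>i j. homogeneous (int (D j)) (B i j)"
      and C: "\<And>i. homogeneous (e - (int d - 1) - int (D i)) (vec_nth C i)"
      and gJ: "range (dot g) = jacobian_ideal f" and syz1: "\<And>v. dot g v = 0 \<longleftrightarrow> (\<exists>w. v = mat_act B w)"
      and syz2: "\<And>w. mat_act B w = 0 \<longleftrightarrow> (\<exists>q. w = q *s C)" and inj: "\<And>q. q *s C = 0 \<Longrightarrow> q = 0"
    by blast
  obtain \<alpha> where \<alpha>: "\<And>L. L \<in> \<L> \<Longrightarrow> L = zeros_linear_form (\<alpha> L)"
      and f: "f = (\<Prod>L\<in>\<L>. linear_form (\<alpha> L))"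
    using assms(3) unfolding defining_polynomial_def by blast
  define F where "F = \<alpha> ` \<L>"
  have inj\<alpha>: "inj_on \<alpha> \<L>" and arr: "arrangement_forms F"
    using arrangement_forms_image[OF assms(1) \<alpha>] by (simp_all add: F_def)
  have finL: "finite \<L>" using assms(1) by (simp add: line_arrangement_def)
  have finF: "finite F" using finL by (simp add: F_def)
  have cardF: "card F = d" using card_image[OF inj\<alpha>] assms(2) by (simp add: F_def)
  then have F: "F \<noteq> {}" using d12 le by auto
  have "f = (\<Prod>b\<in>F. linear_form b)"
    unfolding f F_def by (simp add: prod.reindex[OF inj\<alpha>])
  then have "vec_lambda (\<lambda>i. partial i f) = grad F"
    using partial_prod_linear_form[OF finF] by (simp add: Finite_Cartesian_Product.vec_eq_iff)
  \<comment> \<open>The generators \<open>g\<close> of the resolution and the partial derivatives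
    generate the same ideal and have the same degree d - 1, so their syzygies have equal dimensions
    in each degree.\<close>
  then have "range (dot g) = range (dot (grad F))"
    using gJ jacobian_ideal_eq[of f] by simp
  moreover have "homogeneous (int d - 1) (vec_nth (grad F) i)" for i
    using homogeneous_grad[OF finF F] cardF by simp
  ultimately have "dot g ` forms3 (\<lambda>_. k) = dot (grad F) ` forms3 (\<lambda>_. k)" for k
    using dot_image_subset[of "int d - 1" g "grad F"] dot_image_subset[of "int d - 1" "grad F" g] g
    by (intro subset_antisym) auto
  then have "int (S3_vs.dim (syzygies (grad F) k)) = int (S3_vs.dim (syzygies g k))" for k
    using dim_syzygies[of k g] dim_syzygies[of k "grad F"] by simp
  moreover have "int (S3_vs.dim (syzygies g k)) =
      (\<Sum>i\<in>UNIV. hilb (k - int (D i))) - hilb (k - (e - (int d - 1)))" for k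
    using dim_syzygies_resolution[OF B C syz1 syz2 inj] .
  ultimately have hf: "int (S3_vs.dim (deriv_module F k)) =
      hilb (k - 1) + hilb (k - d1) + hilb (k - d2) + hilb (k - d3) - hilb (k - (e - (int d - 1)))" for k
    using dim_deriv_module_syzygies[OF arr F, of k] by (simp add: sum_3 D)
  note arr_hf = arrangement_hilbert_function[OF assms(1) \<alpha>, folded F_def, unfolded assms(2)]
  define M where "M = multiple_points \<L>"
  define r where "r P = int (mult_at \<L> P)" for P
  have finM: "finite M" and pairs: "(\<Sum>P\<in>M. r P * (r P - 1)) = int d * (int d - 1)"
    using arr_hf by (simp_all add: M_def r_def)
  have b: "b2 \<L> = (\<Sum>P\<in>M. r P - 1)" by (simp add: b2_def M_def r_def)
  have r2: "r P \<ge> 2" if "P \<in> M" for P using that by (simp add: M_def r_def multiple_points_def)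
  have "2 * b2 \<L> \<le> int d * (int d - 1)"
    unfolding b pairs[symmetric] sum_distrib_left
    by (intro sum_mono mult_right_mono) (use r2 in force)+
  moreover have "2 * (hilb (k - 1) + hilb (k - d1) + hilb (k - d2) + hilb (k - d3) - hilb (k - (e - (int d - 1)))) =
      6 * hilb k - 2 * int d * (k + 1) + int d * (int d - 1) - 2 * b2 \<L>" if "k \<ge> 0" "k \<ge> int d - 3" for k
    unfolding hf[of k, symmetric] using arr_hf that by blast
  ultimately have b2: "b2 \<L> = int d1 * int d2 + int d3" and d3: "int d3 \<le> int d - 2"
    using plus_one_generated_numerics[of d1 d2 "int d" d3 "b2 \<L>" "e - (int d - 1)"] d12 le by auto
  have max: "max_mult \<L> = Max (mult_at \<L> ` M)"
    unfolding max_mult_def M_def multiple_points_def by (intro arg_cong[of _ _ Max]) auto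
  \<comment> \<open>There are at least two lines, hence a multiple point; without one,
    \<open>Max\<close> would be taken over the empty set.\<close>
  have "int d * (int d - 1) > 0" using d12 le by simp
  then have "M \<noteq> {}" using pairs by auto
  then obtain P where P: "P \<in> M" by auto
  have r_le: "r P \<le> int (max_mult \<L>)" if "P \<in> M" for P
    unfolding max r_def using finM that by simp
  have m: "max_mult \<L> \<ge> 2" using r_le[OF P] r2[OF P] by simp
  have "int d * (int d - 1) \<le> int (max_mult \<L>) * b2 \<L>"
    unfolding b pairs[symmetric] sum_distrib_left
    by (intro sum_mono mult_right_mono) (use r_le r2 in force)+
  then have "2 * int d \<le> int (max_mult \<L>) * (int d3 + 2)"
    using exponent_lower_bound[of "int d1" "int d2" "int d" "int d3" "int (max_mult \<L>)"] d12 le m b2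
    by simp
  then have "real_of_int (2 * int d) \<le> real_of_int (int (max_mult \<L>) * (int d3 + 2))"
    by (simp only: of_int_le_iff)
  then have "2 * real d / real (max_mult \<L>) - 2 \<le> real d3"
    using m by (simp add: divide_le_eq algebra_simps)
  then have "int d3 \<in> {\<lceil>2 * real d / real (max_mult \<L>) - 2\<rceil> .. int d - 2}"
    using d3 by (simp add: ceiling_le_iff del: ceiling_diff_numeral)
  then have "\<not> splits_over_rationals (P_poly \<L> (int d3))" using assms(5) by blast
  moreover have "splits_over_rationals (P_poly \<L> (int d3))"
  proof -
    have "(\<Sum>r = 2..card \<L>. (int r - 1) * int (t_num \<L> r)) - int d3 = int d1 * int d2"
      using b2_t_num[OF finL] finM b2 by (simp add: M_def)
    then have "P_poly \<L> (int d3) = prod_list [[:1, of_nat d1:], [:1, of_nat d2:]]"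
      unfolding P_poly_def by (simp add: assms(2) flip: d12)
    then show ?thesis unfolding splits_over_rationals_def by (intro exI[of _ "[[:1, of_nat d1:], [:1, of_nat d2:]]"]) simp
  qed
  ultimately show False by contradiction
qed

end
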